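(* Let $E$ be a real separable Banach space. Each generalized Mehler semigroup $(\mathcal{T}_t, t\ge 0)$, $(\mathcal{T}_tf)(x)=\int_E f(T_tx+y)\,\rho_t(dy)$, with $t\mapsto\rho_t$ continuous at zero, is of the form $$(\mathcal{T}_t f)(x)=\mathbf{E}\,[\,f(T_t x+Z(t))\,],\qquad f\in C_b(E),\ x\in E,\ t\ge 0,$$ for some $C_0$-semigroup $(T_t, t\ge 0)$ of bounded linear operators on $E$ and some $E$-valued càdlàg process $(Z(t), t\ge 0)$ with independent increments, $Z(0)=0$ almost surely and $Z(t)-Z(s)\stackrel{d}{=}T_s Z(t-s)$ for all $t\ge s\ge 0$.
   Context: $C_b(E)$ is the space of real-valued bounded continuous functions on $E$. Continuity of $t\mapsto\rho_t$ is with respect to weak convergence of Borel probability measures on $E$. $\stackrel{d}{=}$ means equality in distribution; càdlàg means right continuous paths with left limits; $\mathbf{E}[\cdot]$ is expectation. A $C_0$-semigroup on $E$ is a family $(T_t)_{t\ge 0}$ of bounded linear operators with $T_0=I$, $T_tT_s=T_{t+s}$ for $s,t\ge0$, and $t\mapsto T_t x$ continuous for each $x\in E$. A generalized Mehler semigroup is a one-parameter semigroup of operators $(\mathcal{T}_t)_{t\ge 0}$ on $C_b(E)$ (i.e. $\mathcal{T}_t\mathcal{T}_s=\mathcal{T}_{t+s}$ for all $s,t\ge0$) of the form $(\mathcal{T}_t f)(x)=\int_E f(T_t x+y)\,\rho_t(dy)$ for $f\in C_b(E)$, $x\in E$, where $(T_t)_{t\ge 0}$ is a $C_0$-semigroup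 on $E$ and $\rho_t$, $t\ge 0$, are Borel probability measures on $E$. *)

theory Defs
  imports "HOL-Probability.Probability"
begin

definition C0_semigroup :: "(real \<Rightarrow> 'e \<Rightarrow>\<^sub>L 'e::real_normed_vector) \<Rightarrow> bool" where
  "C0_semigroup T \<longleftrightarrow>
     T 0 = id_blinfun \<and>
     (\<forall>s\<ge>0. \<forall>t\<ge>0. T (t + s) = T t o\<^sub>L T s) \<and>
     (\<forall>x. continuous_on {0..} (\<lambda>t. T t x))"

text \<open>The library's \<^const>\<open>weak_conv_m\<close> only covers sequences of measures on the real line.\<close>

definition weakly_tendsto ::
  "('i \<Rightarrow> 'a::topological_space measure) \<Rightarrow> 'a measure \<Rightarrow> 'i filter \<Rightarrow> bool" where
  "weakly_tendsto \<mu> \<nu> F \<longleftrightarrow>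
     (\<forall>f :: 'a \<Rightarrow>\<^sub>C real. ((\<lambda>i. \<integral>y. f y \<partial>\<mu> i) \<longlongrightarrow> (\<integral>y. f y \<partial>\<nu>)) F)"

text \<open>The operators \<open>P t\<close> on $C_b(E)$ are the semigroup; \<open>T\<close> and \<open>\<rho>\<close> are the data representing it.
  Only values at nonnegative times are constrained.\<close>

definition generalized_Mehler_semigroup ::
  "(real \<Rightarrow> ('e \<Rightarrow>\<^sub>C real) \<Rightarrow>\<^sub>L ('e \<Rightarrow>\<^sub>C real)) \<Rightarrow>
   (real \<Rightarrow> 'e \<Rightarrow>\<^sub>L 'e) \<Rightarrow> (real \<Rightarrow> 'e::real_normed_vector measure) \<Rightarrow> bool" where
  "generalized_Mehler_semigroup P T \<rho> \<longleftrightarrow>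
     C0_semigroup T \<and>
     (\<forall>t\<ge>0. prob_space (\<rho> t) \<and> sets (\<rho> t) = sets borel) \<and>
     (\<forall>s\<ge>0. \<forall>t\<ge>0. P t o\<^sub>L P s = P (t + s)) \<and>
     (\<forall>t\<ge>0. \<forall>f x. P t f x = (\<integral>y. f (T t x + y) \<partial>\<rho> t))"

definition cadlag :: "(real \<Rightarrow> 'e::topological_space) \<Rightarrow> bool" where
  "cadlag z \<longleftrightarrow>
     (\<forall>t\<ge>0. continuous (at_right t) z) \<and>
     (\<forall>t>0. \<exists>l. (z \<longlongrightarrow> l) (at_left t))"

definition independent_increments ::
  "'w measure \<Rightarrow> (real \<Rightarrow> 'w \<Rightarrow> 'e::real_normed_vector) \<Rightarrow> bool" where
  "independent_increments M Z \<longleftrightarrow>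
     (\<forall>n. \<forall>t :: nat \<Rightarrow> real. 0 \<le> t 0 \<and> (\<forall>i<n. t i \<le> t (Suc i)) \<longrightarrow>
        prob_space.indep_vars M (\<lambda>_. borel) (\<lambda>i \<omega>. Z (t (Suc i)) \<omega> - Z (t i) \<omega>) {..<n})"

end

theory Submission
  imports Defs
begin

text \<open>Comparing \<open>P (t + s)\<close> with \<open>P t\<close> after \<open>P s\<close> at the origin shows that \<open>\<rho> (s + t)\<close> is the convolution of \<open>\<rho> s\<close> with
  the image of \<open>\<rho> t\<close> under \<open>T s\<close>. Hence the images \<open>\<mu> s t\<close> of \<open>\<rho> (t - s)\<close> under \<open>T s\<close> satisfy
  \<open>\<mu> s t * \<mu> t u = \<mu> s u\<close> and are the increment laws of a process \<open>X\<close> with independent increments, by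
  Kolmogorov's extension theorem. As \<open>\<mu> s s\<close> is idempotent, it is the point mass at \<open>0\<close>; with the local
  boundedness of \<open>T\<close>, continuity of \<open>\<rho>\<close> at \<open>0\<close> makes \<open>X\<close> stochastically continuous, locally uniformly in time.
  On an interval where all increments exceed \<open>e\<close> with probability at most \<open>1/4\<close>, an Ottaviani type supermartingale
  argument bounds the expectation of \<open>2 ^ c\<close> by \<open>2\<close>, where \<open>c\<close> counts the oscillations of size \<open>4 * e\<close> along an
  arbitrary finite set of times. So almost surely the restriction of \<open>X\<close> to the rationals has one-sided limits
  everywhere, and its right limits form the desired modification.\<close>

section \<open>Oscillations and one-sided limits\<close>

text \<open>The increments need not have moments and \<open>E\<close> may have infinite dimension,
  so path regularity must come from probabilities of norms alone. Upcrossings would need an order on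
  the values; chains of pairs at distance more than a threshold take their place. The count has to
  be controlled independently of the number of times. This is why every increment inside the short
  interval, and not only each consecutive one, must be small in probability. Three thresholds
  interact. An increment exceeds \<open>e\<close> with probability at most \<open>1/4\<close>. A
  deviation beyond \<open>2 * e\<close> is therefore still beyond \<open>e\<close> at the end of the
  interval with probability at least \<open>3/4\<close>, so \<open>2 * e\<close> is where the
  comparison walk restarts. Two positions of that walk differ by at most \<open>4 * e\<close>, hence
  this size of the oscillations. The operators \<open>T\<close> enter only through the laws of the
  increments: once these are known to form a hemigroup that is uniformly small near the diagonal,
  the construction of the process never mentions them. Continuity of \<rho> at the single time
  \<open>0\<close> suffices because every \<mu> is the image of some \<rho> at a short time.\<close>

fun osc :: "('a::linorder \<Rightarrow> 'b::metric_space) \<Rightarrow> real \<Rightarrow> nat \<Rightarrow> 'a set \<Rightarrow> bool" where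
  "osc x e 0 A \<longleftrightarrow> True"
| "osc x e (Suc p) A \<longleftrightarrow> (\<exists>a\<in>A. \<exists>b\<in>A. a < b \<and> e < dist (x a) (x b) \<and> osc x e p (A \<inter> {b..}))"

lemma osc_mono: "osc x e p A \<Longrightarrow> A \<subseteq> B \<Longrightarrow> osc x e p B"
proof (induction p arbitrary: A B)
  case (Suc p)
  then obtain a b where ab: "a \<in> A" "b \<in> A" "a < b" "e < dist (x a) (x b)" "osc x e p (A \<inter> {b..})"
    by auto
  have "osc x e p (B \<inter> {b..})" using Suc.IH[OF ab(5)] Suc.prems(2) by blast
  then show ?case using ab Suc.prems(2) by auto
qed simp

lemma osc_antimono: "osc x e p A \<Longrightarrow> e' \<le> e \<Longrightarrow> osc x e' p A"
proof (induction p arbitrary: A)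
  case (Suc p)
  then obtain a b where ab: "a \<in> A" "b \<in> A" "a < b" "e < dist (x a) (x b)" "osc x e p (A \<inter> {b..})"
    by auto
  with Suc.IH[OF ab(5) Suc.prems(2)] Suc.prems(2) have "e' < dist (x a) (x b)" "osc x e' p (A \<inter> {b..})"
    by auto
  with ab show ?case by auto
qed simp

text \<open>Each oscillation is witnessed by two points. This lets a bound that is uniform over
  finite time sets reach countable ones.\<close>

lemma osc_finite: "osc x e p A \<Longrightarrow> \<exists>F\<subseteq>A. finite F \<and> osc x e p F"
proof (induction p arbitrary: A)
  case 0
  show ?case by (rule exI[of _ "{}"]) simp
next
  case (Suc p)
  then obtain a b where ab: "a \<in> A" "b \<in> A" "a < b" "e < dist (x a) (x b)" "osc x e p (A \<inter> {b..})"
    by auto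
  from Suc.IH[OF ab(5)] obtain F where F: "F \<subseteq> A \<inter> {b..}" "finite F" "osc x e p F" by blast
  have "osc x e p (insert a (insert b F) \<inter> {b..})"
    using F(1) by (intro osc_mono[OF F(3)]) auto
  with ab F show ?case
    by (intro exI[of _ "insert a (insert b F)"]) auto
qed

text \<open>If the image filter is not Cauchy, a pair at distance more than \<open>e/2\<close>
  exists in every right neighbourhood of \<open>t\<close>. Pairs chosen ever closer to
  \<open>t\<close> then form arbitrarily long chains, against the premise; completeness turns the
  Cauchy property into a limit.\<close>

lemma finite_osc_imp_tendsto_right:
  fixes x :: "real \<Rightarrow> 'b::complete_space"
  assumes "\<And>e. e > 0 \<Longrightarrow> \<exists>p. \<exists>d>t. \<not> osc x e p (D \<inter> {t<..<d})"
  shows "\<exists>l. (x \<longlongrightarrow> l) (at t within (D \<inter> {t<..}))" (is "\<exists>l. (x \<longlongrightarrow> l) ?F")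
proof (cases "?F = bot")
  case False
  have "cauchy_filter (filtermap x ?F)"
    unfolding cauchy_filter_metric_filtermap
  proof (intro allI impI)
    fix e :: real assume "0 < e"
    show "\<exists>P. eventually P ?F \<and> (\<forall>a b. P a \<and> P b \<longrightarrow> dist (x a) (x b) < e)"
    proof (rule ccontr)
      assume neg: "\<not> ?thesis"
      \<comment> \<open>The failure of the Cauchy property yields distance at least
        \<open>e\<close>; passing to \<open>e/2\<close> gives the strict inequality that
        \<open>osc\<close> asks for.\<close>
      have pair: "\<exists>a b. a \<in> D \<inter> {t<..<d} \<and> b \<in> D \<inter> {t<..<d} \<and> a < b \<and> e/2 < dist (x a) (x b)"
        if "d > t" for d
      proof -
        have "eventually (\<lambda>a. a \<in> D \<inter> {t<..<d}) ?F"
          using that eventually_at_topological[of "\<lambda>a. a \<in> D \<inter> {t<..<d}" t "D \<inter> {t<..}"]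
          by (auto intro!: exI[of _ "{..<d}"])
        then obtain a b where "a \<in> D \<inter> {t<..<d}" "b \<in> D \<inter> {t<..<d}" "dist (x a) (x b) \<ge> e"
          using neg by (meson not_le)
        with \<open>0 < e\<close> show ?thesis
          by (cases a b rule: linorder_cases) (force simp: dist_commute)+
      qed
      \<comment> \<open>The chain grows from right to left: its lower end \<eta> stays strictly
        above \<open>t\<close>, which leaves room for a further pair in front of it.\<close>
      have "\<exists>\<eta>>t. osc x (e/2) p (D \<inter> {\<eta>..<d})" if "d > t" for p d
        using that
      proof (induction p)
        case 0
        then show ?case by (intro exI[of _ d]) auto
      next
        case (Suc p)
        then obtain \<eta> where \<eta>: "\<eta> > t" "osc x (e/2) p (D \<inter> {\<eta>..<d})" by blast
        with Suc.prems have "min \<eta> d > t" by simp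
        from pair[OF this] obtain a b where
          ab: "a \<in> D \<inter> {t<..<min \<eta> d}" "b \<in> D \<inter> {t<..<min \<eta> d}" "a < b" "e/2 < dist (x a) (x b)"
          by blast
        have "osc x (e/2) p (D \<inter> {a..<d} \<inter> {b..})"
          using ab by (intro osc_mono[OF \<eta>(2)]) auto
        with ab show ?case
          by (intro exI[of _ a]) force
      qed
      then have "osc x (e/2) p (D \<inter> {t<..<d})" if "d > t" for p d
        using that by (meson osc_mono greaterThanLessThan_iff atLeastLessThan_iff less_le_trans
            Int_mono order_refl subsetI)
      with assms[of "e/2"] \<open>0 < e\<close> show False by auto
    qed
  qed
  from cauchy_filter_complete_converges[OF this complete_UNIV] False
  obtain c where "filtermap x ?F \<le> nhds c"
    by (auto simp: filtermap_bot_iff)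
  then show ?thesis by (auto simp: filterlim_def)
qed simp

text \<open>Approaching \<open>t\<close> from the left agrees with the direction of the recursion in
  \<open>osc\<close>, so the induction only has to leave \<open>d\<close> free and restart it at
  \<open>b\<close>.\<close>

lemma finite_osc_imp_tendsto_left:
  fixes x :: "real \<Rightarrow> 'b::complete_space"
  assumes "\<And>e. e > 0 \<Longrightarrow> \<exists>p. \<exists>d<t. \<not> osc x e p (D \<inter> {d<..<t})"
  shows "\<exists>l. (x \<longlongrightarrow> l) (at t within (D \<inter> {..<t}))" (is "\<exists>l. (x \<longlongrightarrow> l) ?F")
proof (cases "?F = bot")
  case False
  have "cauchy_filter (filtermap x ?F)"
    unfolding cauchy_filter_metric_filtermap
  proof (intro allI impI)
    fix e :: real assume "0 < e"
    show "\<exists>P. eventually P ?F \<and> (\<forall>a b. P a \<and> P b \<longrightarrow> dist (x a) (x b) < e)"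
    proof (rule ccontr)
      assume neg: "\<not> ?thesis"
      have pair: "\<exists>a b. a \<in> D \<inter> {d<..<t} \<and> b \<in> D \<inter> {d<..<t} \<and> a < b \<and> e/2 < dist (x a) (x b)"
        if "d < t" for d
      proof -
        have "eventually (\<lambda>a. a \<in> D \<inter> {d<..<t}) ?F"
          using that eventually_at_topological[of "\<lambda>a. a \<in> D \<inter> {d<..<t}" t "D \<inter> {..<t}"]
          by (auto intro!: exI[of _ "{d<..}"])
        then obtain a b where "a \<in> D \<inter> {d<..<t}" "b \<in> D \<inter> {d<..<t}" "dist (x a) (x b) \<ge> e"
          using neg by (meson not_le)
        with \<open>0 < e\<close> show ?thesis
          by (cases a b rule: linorder_cases) (force simp: dist_commute)+
      qed
      have "osc x (e/2) p (D \<inter> {d<..<t})" if "d < t" for p d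
        using that
      proof (induction p arbitrary: d)
        case (Suc p)
        obtain a b where
          ab: "a \<in> D \<inter> {d<..<t}" "b \<in> D \<inter> {d<..<t}" "a < b" "e/2 < dist (x a) (x b)"
          using pair[OF Suc.prems] by blast
        have "osc x (e/2) p (D \<inter> {b<..<t})"
          using ab by (intro Suc.IH) auto
        then have "osc x (e/2) p (D \<inter> {d<..<t} \<inter> {b..})"
          using ab by (elim osc_mono) auto
        with ab show ?case unfolding osc.simps by blast
      qed simp
      with assms[of "e/2"] \<open>0 < e\<close> show False by auto
    qed
  qed
  from cauchy_filter_complete_converges[OF this complete_UNIV] False
  obtain c where "filtermap x ?F \<le> nhds c"
    by (auto simp: filtermap_bot_iff)
  then show ?thesis by (auto simp: filterlim_def)
qed simp

text \<open>A closed bound \<open>dist (x s) l \<le> e/2\<close> near \<open>t\<close> is inherited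
  by the right limits \<open>z u\<close>, because points of \<open>D\<close> just after
  \<open>u\<close> stay in the open set \<open>U\<close>. With \<open>U\<close> to the right of
  \<open>t\<close> this gives right continuity of \<open>z\<close>, with \<open>U\<close> to the
  left it gives left limits.\<close>

lemma tendsto_right_limits:
  fixes x z :: "real \<Rightarrow> 'b::metric_space"
  assumes "open U"
    and lim: "(x \<longlongrightarrow> l) (at t within (D \<inter> U))"
    and z: "\<And>u. u \<in> U \<Longrightarrow> (x \<longlongrightarrow> z u) (at u within (D \<inter> {u<..}))"
    and nontriv: "\<And>u. u \<in> U \<Longrightarrow> at u within (D \<inter> {u<..}) \<noteq> bot"
    and "t \<notin> U"
  shows "(z \<longlongrightarrow> l) (at t within U)"
proof (rule tendstoI)
  fix e :: real assume "e > 0"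
  with lim have "eventually (\<lambda>s. dist (x s) l < e/2) (at t within (D \<inter> U))"
    by (intro tendstoD) auto
  then obtain V where V: "open V" "t \<in> V" "\<And>s. s \<in> V \<Longrightarrow> s \<in> D \<inter> U \<Longrightarrow> dist (x s) l < e/2"
    using \<open>t \<notin> U\<close> unfolding eventually_at_topological by (metis IntE)
  have "dist (z u) l < e" if u: "u \<in> V" "u \<in> U" for u
  proof -
    have "eventually (\<lambda>s. s \<in> V \<inter> U \<and> s \<in> D) (at u within (D \<inter> {u<..}))"
      using V \<open>open U\<close> u by (auto simp: eventually_at_topological intro!: exI[of _ "V \<inter> U"])
    then have "eventually (\<lambda>s. dist (x s) l \<le> e/2) (at u within (D \<inter> {u<..}))"
      by eventually_elim (use V(3) in force)
    moreover have "((\<lambda>s. dist (x s) l) \<longlongrightarrow> dist (z u) l) (at u within (D \<inter> {u<..}))"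
      by (intro tendsto_intros z u)
    ultimately have "dist (z u) l \<le> e/2"
      using nontriv[OF u(2)] by (intro tendsto_upperbound)
    with \<open>e > 0\<close> show ?thesis by simp
  qed
  with V(1,2) show "eventually (\<lambda>u. dist (z u) l < e) (at t within U)"
    unfolding eventually_at_topological by blast
qed

text \<open>The premise on \<open>z\<close> only asks it to agree with a limit that exists, so
  \<open>z\<close> may be defined by \<open>Lim\<close> before convergence is known.\<close>

lemma cadlag_right_limits:
  fixes x :: "real \<Rightarrow> 'b::complete_space"
  assumes dense: "\<And>a b. 0 \<le> a \<Longrightarrow> a < b \<Longrightarrow> \<exists>d\<in>D. a < d \<and> d < b"
    and right: "\<And>e t. e > 0 \<Longrightarrow> t \<ge> 0 \<Longrightarrow> \<exists>p. \<exists>d>t. \<not> osc x e p (D \<inter> {t<..<d})"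
    and left: "\<And>e t. e > 0 \<Longrightarrow> t > 0 \<Longrightarrow> \<exists>p. \<exists>d<t. \<not> osc x e p (D \<inter> {d<..<t})"
    and z: "\<And>t l. t \<ge> 0 \<Longrightarrow> (x \<longlongrightarrow> l) (at t within (D \<inter> {t<..})) \<Longrightarrow> z t = l"
  shows "cadlag z" and "\<And>t. t \<ge> 0 \<Longrightarrow> (x \<longlongrightarrow> z t) (at t within (D \<inter> {t<..}))"
proof -
  show lim: "(x \<longlongrightarrow> z t) (at t within (D \<inter> {t<..}))" if "t \<ge> 0" for t
    using finite_osc_imp_tendsto_right[OF right] z that by metis
  have nontriv: "at u within (D \<inter> {u<..}) \<noteq> bot" if "u \<ge> 0" for u
  proof -
    have "\<exists>s\<in>D \<inter> {u<..}. s \<noteq> u \<and> dist s u < e" if "e > 0" for e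
      using dense[OF \<open>u \<ge> 0\<close>, of "u + e"] that by (force simp: dist_real_def)
    then show ?thesis
      by (metis islimpt_approachable trivial_limit_within)
  qed
  show "cadlag z"
    unfolding cadlag_def continuous_within
  proof safe
    fix t :: real assume t: "t \<ge> 0"
    show "(z \<longlongrightarrow> z t) (at_right t)"
      by (rule tendsto_right_limits[where x = x and D = D]) (use lim[OF t] lim nontriv t in auto)
  next
    fix t :: real assume t: "t > 0"
    obtain l where l: "(x \<longlongrightarrow> l) (at t within (D \<inter> {..<t}))"
      using finite_osc_imp_tendsto_left[OF left] t by blast
    \<comment> \<open>The values of \<open>z\<close> are controlled at nonnegative times only;
      cutting off at \<open>0\<close> does not change the filter since \<open>t > 0\<close>.\<close>
    have "(z \<longlongrightarrow> l) (at t within {0<..<t})"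
      by (rule tendsto_right_limits[where x = x and D = D])
        (use lim nontriv in \<open>auto intro: tendsto_within_subset[OF l]\<close>)
    moreover have "at t within {0<..<t} = at_left t"
      using t by (intro at_within_nhd[of _ "{0<..}"]) auto
    ultimately show "\<exists>l. (z \<longlongrightarrow> l) (at_left t)" by auto
  qed
qed

section \<open>Bounded continuous functions, idempotent measures and uniform boundedness\<close>

lemma bcontfun_exists:
  fixes g :: "'a::topological_space \<Rightarrow> real"
  assumes "continuous_on UNIV g" "\<And>x. \<bar>g x\<bar> \<le> c"
  obtains f :: "'a \<Rightarrow>\<^sub>C real" where "apply_bcontfun f = g"
proof -
  have "g \<in> bcontfun"
    using assms by (auto simp: bcontfun_def bounded_iff)
  then show ?thesis using that Bcontfun_inverse by blast
qed

lemma borel_measurable_bcontfun [measurable]: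
  fixes f :: "'a::topological_space \<Rightarrow>\<^sub>C real"
  shows "apply_bcontfun f \<in> borel_measurable borel"
  by (intro borel_measurable_continuous_onI) (simp add: continuous_on_apply_bcontfun)

lemma (in finite_measure) integrable_bcontfun:
  fixes f :: "'b::topological_space \<Rightarrow>\<^sub>C real"
  assumes [measurable]: "X \<in> borel_measurable M"
  shows "integrable M (\<lambda>x. f (X x))"
  by (rule integrable_const_bound[of _ "norm f"]) (auto simp: norm_bounded[of f, unfolded real_norm_def])

text \<open>The indicator of a closed set is a pointwise limit of bounded continuous functions, and
  the closed sets form an intersection-stable generator of the Borel sets.\<close>

lemma finite_measure_eqI_bcontfun:
  fixes M N :: "'a::metric_space measure"
  assumes M: "finite_measure M" "sets M = sets borel"
    and N: "finite_measure N" "sets N = sets borel"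
    and eq: "\<And>f :: 'a \<Rightarrow>\<^sub>C real. (\<integral>x. f x \<partial>M) = (\<integral>x. f x \<partial>N)"
  shows "M = N"
proof -
  interpret M: finite_measure M by fact
  interpret N: finite_measure N by fact
  have [simp]: "space M = UNIV" "space N = UNIV"
    using M(2) N(2) by (auto dest: sets_eq_imp_space_eq)
  note [measurable_cong] = M(2) N(2)
  have meas: "measure M C = measure N C" if C: "closed C" "C \<noteq> {}" for C
  proof -
    have [measurable]: "C \<in> sets borel" using C by simp
    \<comment> \<open>As \<open>infdist x {} = 0\<close>, these functions would be constantly
      \<open>1\<close> for the empty set, which is treated separately below.\<close>
    define g where "g n x = max 0 (1 - real n * infdist x C)" for n x
    have g_cont: "continuous_on UNIV (g n)" for n
      unfolding g_def by (intro continuous_intros)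
    then have [measurable]: "g n \<in> borel_measurable borel" for n
      by (rule borel_measurable_continuous_onI)
    have g_bd: "\<bar>g n x\<bar> \<le> 1" for n x
      by (auto simp: g_def infdist_nonneg)
    have g_lim: "(\<lambda>n. g n x) \<longlonglongrightarrow> indicator C x" for x
    proof (cases "x \<in> C")
      case True
      then show ?thesis using C by (simp add: g_def)
    next
      case False
      then have pos: "infdist x C > 0"
        using C by (simp add: infdist_pos_not_in_closed)
      obtain k where k: "1 < real k * infdist x C"
        using reals_Archimedean3[OF pos] by blast
      have "g n x = 0" if "n \<ge> k" for n
      proof -
        have "real k * infdist x C \<le> real n * infdist x C"
          using that pos by (intro mult_right_mono) auto
        with k show ?thesis by (simp add: g_def)
      qed
      then have "eventually (\<lambda>n. g n x = 0) sequentially"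
        by (auto simp: eventually_sequentially)
      with False show ?thesis by (simp add: tendsto_eventually)
    qed
    have eq_g: "(\<integral>x. g n x \<partial>M) = (\<integral>x. g n x \<partial>N)" for n
      using bcontfun_exists[OF g_cont g_bd] eq by metis
    have "(\<lambda>n. \<integral>x. g n x \<partial>M) \<longlonglongrightarrow> (\<integral>x. indicat_real C x \<partial>M)"
      by (rule integral_dominated_convergence[where w = "\<lambda>_. 1"]) (use C g_lim g_bd in auto)
    moreover have "(\<lambda>n. \<integral>x. g n x \<partial>M) \<longlonglongrightarrow> (\<integral>x. indicat_real C x \<partial>N)"
      unfolding eq_g
      by (rule integral_dominated_convergence[where w = "\<lambda>_. 1"]) (use C g_lim g_bd in auto)
    ultimately have "(\<integral>x. indicat_real C x \<partial>M) = (\<integral>x. indicat_real C x \<partial>N)"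
      by (rule LIMSEQ_unique)
    then show ?thesis
      using C by (simp add: borel_closed M(2) N(2))
  qed
  show ?thesis
  proof (rule measure_eqI_generator_eq[where E = "Collect closed" and \<Omega> = UNIV and A = "\<lambda>_. UNIV"])
    show "emeasure M X = emeasure N X" if "X \<in> Collect closed" for X
      using meas[of X] that by (cases "X = {}") (auto simp: M.emeasure_eq_measure N.emeasure_eq_measure)
  qed (use M N in \<open>auto simp: Int_stable_def borel_eq_closed M.emeasure_eq_measure\<close>)
qed

lemma eq_return_if_AE_eq:
  fixes M :: "'a::topological_space measure"
  assumes "prob_space M" and "sets M = sets borel" and ae: "AE y in M. y = c"
  shows "M = return borel c"
proof (rule measure_eqI)
  interpret prob_space M by fact
  fix A assume A: "A \<in> sets M"
  show "emeasure M A = emeasure (return borel c) A"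
  proof (cases "c \<in> A")
    case True
    with ae have "AE y in M. y \<in> A" by auto
    then have "emeasure M A = 1" using A by (simp add: emeasure_eq_1_AE)
    with True A assms(2) show ?thesis by simp
  next
    case False
    with ae have "AE y in M. y \<notin> A" by auto
    then have "emeasure M A = 0" using A by (simp add: AE_iff_measurable[OF _ refl] sets.sets_into_space
          AE_iff_null_sets null_setsD1)
    with False A assms(2) show ?thesis by simp
  qed
qed (use assms in auto)

text \<open>By the Lindelof property the union of all open null sets is already a countable union of
  them, hence null.\<close>

lemma AE_in_support:
  fixes M :: "'a::second_countable_topology measure"
  assumes "sets M = sets borel"
  shows "AE x in M. \<forall>U. open U \<longrightarrow> x \<in> U \<longrightarrow> emeasure M U \<noteq> 0"
proof -
  let ?F = "{U. open U \<and> emeasure M U = 0}"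
  obtain F' where F': "F' \<subseteq> ?F" "countable F'" "\<Union>F' = \<Union>?F"
    using Lindelof[of ?F] by blast
  have "\<Union>F' \<in> null_sets M"
    using F'(1,2) assms by (intro null_sets_UN'[of _ "\<lambda>x. x", simplified]) (auto simp: null_sets_def)
  then show ?thesis
    by (rule AE_I') (use F'(3) in auto)
qed

text \<open>Averaging a positive function \<open>f\<close> that decays at infinity gives a function
  \<open>g\<close> that is invariant under translations by points of the support of
  \<open>M\<close>. The support is closed under addition, so a nonzero point \<open>y\<close> in it
  would carry \<open>g\<close> unchanged to infinity, where \<open>g\<close> tends to
  \<open>0\<close> although \<open>g y > 0\<close>. No local compactness enters.\<close>

lemma idempotent_measure_eq_return:
  fixes M :: "'a::{real_normed_vector, second_countable_topology} measure"
  assumes "prob_space M" and sets: "sets M = sets borel"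
    and idem: "distr (M \<Otimes>\<^sub>M M) borel (\<lambda>(x, y). x + y) = M"
  shows "M = return borel 0"
proof -
  interpret M: prob_space M by fact
  interpret MM: pair_prob_space M M ..
  have [simp]: "space M = UNIV" using sets by (auto dest: sets_eq_imp_space_eq)
  have [simp]: "measure M UNIV = 1" using M.prob_space by simp
  note [measurable_cong] = sets
  \<comment> \<open>Four properties matter: continuity, the bound \<open>1\<close>, strict
    positivity, and decay along the multiples of a nonzero vector.\<close>
  define f where "f y = 1 / (1 + norm y)" for y :: 'a
  have f_cont: "continuous_on UNIV f"
    unfolding f_def by (intro continuous_intros) (metis add_pos_nonneg less_irrefl norm_ge_zero zero_less_one)
  then have [measurable]: "f \<in> borel_measurable borel"
    by (rule borel_measurable_continuous_onI)
  have f_pos: "0 < f y" for y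
    by (simp add: f_def add_pos_nonneg)
  have f_bd: "norm (f y) \<le> 1" for y
    by (simp add: f_def add_pos_nonneg)
  define g where "g x = (\<integral>y. f (x + y) \<partial>M)" for x
  have [measurable]: "g \<in> borel_measurable borel"
    unfolding g_def by measurable
  have f_int: "integrable M (\<lambda>y. f (x + y))" for x
    using f_bd by (intro M.integrable_const_bound[of _ 1]) auto
  have g_bd: "norm (g x) \<le> 1" for x
  proof -
    have "(\<integral>y. norm (f (x + y)) \<partial>M) \<le> 1"
      using f_bd by (intro M.integral_le_const integrable_norm f_int) auto
    with integral_norm_bound show ?thesis unfolding g_def by (rule order_trans)
  qed
  have g_seq: "(\<lambda>n. g (u n)) \<longlonglongrightarrow> (\<integral>y. h y \<partial>M)"
    if "\<And>y. (\<lambda>n. f (u n + y)) \<longlonglongrightarrow> h y" and [measurable]: "h \<in> borel_measurable borel" for u h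
    unfolding g_def
    by (rule integral_dominated_convergence[where w = "\<lambda>_. 1"]) (use that f_bd in auto)
  have g_cont: "continuous_on UNIV g"
    unfolding continuous_on_sequentially
  proof (safe, unfold comp_def)
    fix u :: "nat \<Rightarrow> 'a" and a assume u: "u \<longlonglongrightarrow> a"
    have "(\<lambda>n. f (u n + y)) \<longlonglongrightarrow> f (a + y)" for y
      by (rule continuous_on_tendsto_compose[OF f_cont]) (auto intro!: tendsto_intros u)
    from g_seq[OF this] show "(\<lambda>n. g (u n)) \<longlonglongrightarrow> g a"
      unfolding g_def by simp
  qed
  have add: "(\<integral>x. \<integral>y. h (x + y) \<partial>M \<partial>M) = (\<integral>x. h x \<partial>M)"
    if [measurable]: "h \<in> borel_measurable borel" and bd: "\<And>x. norm (h x) \<le> B" for h :: "'a \<Rightarrow> real" and B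
  proof -
    have "(\<integral>x. h x \<partial>M) = (\<integral>x. h x \<partial>(distr (M \<Otimes>\<^sub>M M) borel (\<lambda>(x, y). x + y)))"
      using idem by simp
    also have "\<dots> = (\<integral>p. h (fst p + snd p) \<partial>(M \<Otimes>\<^sub>M M))"
      by (subst integral_distr) (auto simp: case_prod_unfold)
    also have "\<dots> = (\<integral>x. \<integral>y. h (x + y) \<partial>M \<partial>M)"
    proof -
      have "integrable (M \<Otimes>\<^sub>M M) (\<lambda>p. h (fst p + snd p))"
        using bd by (intro MM.integrable_const_bound[of _ B]) auto
      from MM.integral_fst'[OF this] show ?thesis by simp
    qed
    finally show ?thesis ..
  qed
  \<comment> \<open>Idempotence makes \<open>g\<close> harmonic: averaging over one further
    independent summand changes nothing.\<close>
  have gg: "(\<integral>y. g (x + y) \<partial>M) = g x" for x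
    using add[of "\<lambda>w. f (x + w)" 1] f_bd by (simp add: g_def add.assoc)
  have g_int: "integrable M (\<lambda>y. g (x + y))" "integrable M g"
    and g2_int: "integrable M (\<lambda>y. (g (x + y))\<^sup>2)" for x
    using g_bd by (auto intro!: M.integrable_const_bound[of _ 1] simp: abs_square_le_1)
  \<comment> \<open>The process \<open>n \<mapsto> g (X\<^sub>1 + \<dots> + X\<^sub>n)\<close> is a stationary martingale, hence constant.\<close>
  let ?q = "\<lambda>p. (g (fst p + snd p) - g (fst p))\<^sup>2"
  have q_int: "integrable (M \<Otimes>\<^sub>M M) ?q"
  proof (rule MM.integrable_const_bound[of _ 4])
    have "(a - b)\<^sup>2 \<le> 4" if "\<bar>a\<bar> \<le> 1" "\<bar>b\<bar> \<le> 1" for a b :: real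
    proof -
      have "\<bar>a - b\<bar> \<le> 2" using that by linarith
      then have "\<bar>a - b\<bar>\<^sup>2 \<le> 2\<^sup>2" by (intro power_mono) auto
      then show ?thesis by simp
    qed
    then show "AE p in M \<Otimes>\<^sub>M M. norm (?q p) \<le> 4" using g_bd by auto
  qed auto
  \<comment> \<open>By \<open>gg\<close> the mixed term turns the expanded square into a difference
    of two second moments; these agree because \<open>x + y\<close> has the same law as
    \<open>x\<close>.\<close>
  have "integral\<^sup>L (M \<Otimes>\<^sub>M M) ?q = (\<integral>x. \<integral>y. (g (x + y) - g x)\<^sup>2 \<partial>M \<partial>M)"
    using MM.integral_fst'[OF q_int] by simp
  also have "\<dots> = (\<integral>x. (\<integral>y. (g (x + y))\<^sup>2 \<partial>M) - (g x)\<^sup>2 \<partial>M)"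
  proof (rule Bochner_Integration.integral_cong[OF refl])
    fix x
    have "(\<integral>y. (g (x + y) - g x)\<^sup>2 \<partial>M) = (\<integral>y. (g (x + y))\<^sup>2 - 2 * g x * g (x + y) + (g x)\<^sup>2 \<partial>M)"
      by (simp add: power2_diff mult.commute mult.left_commute algebra_simps)
    also have "\<dots> = (\<integral>y. (g (x + y))\<^sup>2 \<partial>M) - 2 * g x * (\<integral>y. g (x + y) \<partial>M) + (g x)\<^sup>2"
      using g_int g2_int[of x] by (simp add: M.prob_space)
    finally show "(\<integral>y. (g (x + y) - g x)\<^sup>2 \<partial>M) = (\<integral>y. (g (x + y))\<^sup>2 \<partial>M) - (g x)\<^sup>2"
      by (simp add: gg power2_eq_square)
  qed
  also have "\<dots> = (\<integral>x. (\<integral>y. (g (x + y))\<^sup>2 \<partial>M) \<partial>M) - (\<integral>x. (g x)\<^sup>2 \<partial>M)"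
  proof (rule Bochner_Integration.integral_diff)
    have "norm (\<integral>y. (g (x + y))\<^sup>2 \<partial>M) \<le> 1" for x
    proof -
      have "(\<integral>y. norm ((g (x + y))\<^sup>2) \<partial>M) \<le> 1"
        using g_bd by (intro M.integral_le_const integrable_norm g2_int) (auto simp: abs_square_le_1)
      with integral_norm_bound show ?thesis by (rule order_trans)
    qed
    then show "integrable M (\<lambda>x. \<integral>y. (g (x + y))\<^sup>2 \<partial>M)"
      by (intro M.integrable_const_bound[of _ 1]) auto
    show "integrable M (\<lambda>x. (g x)\<^sup>2)" using g2_int[of 0] by simp
  qed
  also have "\<dots> = 0"
    using add[of "\<lambda>w. (g w)\<^sup>2" 1] g_bd by (simp add: abs_square_le_1)
  finally have "integral\<^sup>L (M \<Otimes>\<^sub>M M) ?q = 0" .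
  with q_int have "AE p in M \<Otimes>\<^sub>M M. ?q p = 0"
    by (subst (asm) integral_nonneg_eq_0_iff_AE) auto
  then have ae: "AE p in M \<Otimes>\<^sub>M M. g (fst p + snd p) = g (fst p)"
    by auto

  define S where "S = {x. \<forall>U. open U \<longrightarrow> x \<in> U \<longrightarrow> emeasure M U \<noteq> 0}"
  have S_AE: "AE x in M. x \<in> S"
    using AE_in_support[OF sets] by (simp add: S_def)
  \<comment> \<open>Almost sure equality becomes equality on the support: by continuity of
    \<open>g\<close> an exceptional pair would have a product neighbourhood of exceptional pairs, of
    positive measure.\<close>
  have inv: "g (x + y) = g x" if "x \<in> S" "y \<in> S" for x y
  proof (rule ccontr)
    assume neq: "g (x + y) \<noteq> g x"
    have "open {p. g (fst p + snd p) \<noteq> g (fst p)}"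
      by (intro open_Collect_neq continuous_intros continuous_on_compose2[OF g_cont]) auto
    then obtain A B where AB: "open A" "open B" "x \<in> A" "y \<in> B"
      "A \<times> B \<subseteq> {p. g (fst p + snd p) \<noteq> g (fst p)}"
      using neq by (elim open_prod_elim[of _ "(x, y)"]) auto
    have [measurable]: "A \<in> sets borel" "B \<in> sets borel" using AB by auto
    have "AE p in M \<Otimes>\<^sub>M M. p \<notin> A \<times> B"
      using ae by eventually_elim (use AB(5) in auto)
    then have "emeasure (M \<Otimes>\<^sub>M M) (A \<times> B) = 0"
      by (subst AE_iff_measurable[symmetric, where P = "\<lambda>p. p \<notin> A \<times> B"])
        (auto simp: space_pair_measure sets)
    moreover have "emeasure (M \<Otimes>\<^sub>M M) (A \<times> B) = emeasure M A * emeasure M B"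
      by (rule M.emeasure_pair_measure_Times) (auto simp: sets)
    ultimately show False
      using that AB by (auto simp: S_def)
  qed
  have S_add: "x + y \<in> S" if "x \<in> S" "y \<in> S" for x y
    unfolding S_def
  proof safe
    fix U assume U: "open U" "x + y \<in> U" "emeasure M U = 0"
    have "open ((\<lambda>p. fst p + snd p) -` U)"
      by (intro open_vimage U continuous_intros)
    then obtain A B where AB: "open A" "open B" "x \<in> A" "y \<in> B"
      "A \<times> B \<subseteq> (\<lambda>p. fst p + snd p) -` U"
      using U by (elim open_prod_elim[of _ "(x, y)"]) auto
    have [measurable]: "A \<in> sets borel" "B \<in> sets borel" "U \<in> sets borel" using AB U by auto
    have "(\<lambda>p. fst p + snd p) -` U \<inter> space (M \<Otimes>\<^sub>M M) \<in> sets (M \<Otimes>\<^sub>M M)"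
      by measurable
    then have [measurable]: "(\<lambda>p. fst p + snd p) -` U \<in> sets (M \<Otimes>\<^sub>M M)"
      by (simp add: space_pair_measure)
    have "emeasure M A * emeasure M B = emeasure (M \<Otimes>\<^sub>M M) (A \<times> B)"
      by (rule M.emeasure_pair_measure_Times[symmetric]) (auto simp: sets)
    also have "\<dots> \<le> emeasure (M \<Otimes>\<^sub>M M) ((\<lambda>(x, y). x + y) -` U \<inter> space (M \<Otimes>\<^sub>M M))"
      using AB(5) by (intro emeasure_mono) (auto simp: space_pair_measure case_prod_unfold)
    also have "\<dots> = emeasure M U"
      by (subst (2) idem[symmetric], subst emeasure_distr) auto
    finally have "emeasure M A * emeasure M B = 0" using U by simp
    then show False using that AB by (auto simp: S_def)
  qed
  have "AE y in M. y = 0"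
    using S_AE
  proof eventually_elim
    fix y assume y: "y \<in> S"
    show "y = 0"
    proof (rule ccontr)
      assume "y \<noteq> 0"
      \<comment> \<open>These are the multiples \<open>(n + 1) y\<close>: starting at
        \<open>y\<close> itself keeps all of them in \<open>S\<close>.\<close>
      let ?u = "\<lambda>n. y + real n *\<^sub>R y"
      have u: "?u n \<in> S" for n
      proof (induction n)
        case (Suc n)
        from S_add[OF Suc y] show ?case by (simp add: algebra_simps)
      qed (simp add: y)
      have g_u: "g (?u n) = g y" for n
      proof (induction n)
        case (Suc n)
        with inv[OF u[of n] y] show ?case by (simp add: algebra_simps)
      qed simp
      have "(\<lambda>n. f (?u n + z)) \<longlonglongrightarrow> 0" for z
      proof -
        have "f (?u n + z) \<le> 1 / (real n * norm y - norm (y + z))" if "real n * norm y > norm (y + z)" for n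
        proof -
          have "norm (real n *\<^sub>R y) \<le> norm (?u n + z) + norm (y + z)"
            using norm_triangle_ineq4[of "?u n + z" "y + z"] by (simp add: algebra_simps)
          then show ?thesis
            unfolding f_def using that by (intro divide_left_mono mult_pos_pos) auto
        qed
        moreover have top: "filterlim (\<lambda>n. real n * norm y - norm (y + z)) at_top sequentially"
        proof -
          have "filterlim (\<lambda>n. - norm (y + z) + norm y * real n) at_top sequentially"
            using \<open>y \<noteq> 0\<close>
            by (intro filterlim_tendsto_add_at_top[OF tendsto_const]
                filterlim_tendsto_pos_mult_at_top[OF tendsto_const] filterlim_real_sequentially) simp
          then show ?thesis by (simp add: algebra_simps)
        qed
        then have "eventually (\<lambda>n. real n * norm y > norm (y + z)) sequentially"
          using filterlim_at_top_dense[of "\<lambda>n. real n * norm y - norm (y + z)" sequentially]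
          by (auto dest: spec[of _ 0])
        ultimately have upper: "eventually (\<lambda>n. f (?u n + z) \<le> 1 / (real n * norm y - norm (y + z))) sequentially"
          by (auto elim: eventually_mono)
        have lim0: "(\<lambda>n. 1 / (real n * norm y - norm (y + z))) \<longlonglongrightarrow> 0"
          using top by (intro tendsto_divide_0[OF tendsto_const] filterlim_at_top_imp_at_infinity)
        have "eventually (\<lambda>n. 0 \<le> f (?u n + z)) sequentially"
          by (intro always_eventually allI less_imp_le f_pos)
        from this upper tendsto_const lim0 show ?thesis
          by (rule tendsto_sandwich)
      qed
      from g_seq[OF this] have "(\<lambda>n. g y) \<longlonglongrightarrow> 0" by (simp add: g_u)
      then have "g y = 0" using LIMSEQ_const_iff by blast
      moreover have "0 \<le> f w" "f w \<noteq> 0" for w using f_pos[of w] by auto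
      ultimately show False
        using integral_nonneg_eq_0_iff_AE[OF f_int[of y]] by (simp add: g_def)
    qed
  qed
  then show ?thesis
    using assms(1,2) by (intro eq_return_if_AE_eq)
qed

text \<open>By Baire's theorem one of the closed sets \<open>K n\<close> contains a ball. A vector
  of length \<open>r\<close> is the difference of two points of it, whence the bound
  \<open>2 * n / r\<close>.\<close>

lemma uniform_boundedness_principle:
  fixes F :: "'i \<Rightarrow> 'a::banach \<Rightarrow>\<^sub>L 'b::real_normed_vector"
  assumes bd: "\<And>x. bounded ((\<lambda>i. F i x) ` A)"
  shows "bounded (F ` A)"
proof -
  define K where "K n = {x. \<forall>i\<in>A. norm (F i x) \<le> real n}" for n
  have K_closed: "closed (K n)" for n
    unfolding K_def Ball_def
    by (intro closed_Collect_all closed_Collect_imp closed_Collect_le continuous_intros) auto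
  have "\<exists>n. interior (K n) \<noteq> {}"
  proof (rule ccontr)
    assume "\<not> ?thesis"
    then have "euclidean interior_of \<Union>(range K) = {}"
      using K_closed by (intro Baire_category_alt) (auto simp: completely_metrizable_space_euclidean)
    moreover have "\<Union>(range K) = UNIV"
    proof -
      have "\<exists>n. x \<in> K n" for x
      proof -
        obtain b where b: "\<forall>i\<in>A. norm (F i x) \<le> b" using bd[of x] by (auto simp: bounded_iff)
        obtain n where "b \<le> real n" using real_arch_simple by blast
        with b show ?thesis by (intro exI[of _ n]) (auto simp: K_def intro: order_trans)
      qed
      then show ?thesis by auto
    qed
    ultimately show False by simp
  qed
  then obtain n x where "x \<in> interior (K n)" by auto
  then obtain r where r: "r > 0" "cball x r \<subseteq> K n"
    by (meson mem_interior_cball)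
  have "norm (F i) \<le> 2 * real n / r" if i: "i \<in> A" for i
  proof (rule norm_blinfun_bound)
    fix y
    show "norm (F i y) \<le> 2 * real n / r * norm y"
    proof (cases "y = 0")
      case False
      define w where "w = (r / norm y) *\<^sub>R y"
      have "norm w = r" using False r by (simp add: w_def)
      then have "x + w \<in> K n" "x \<in> K n" using r by (auto simp: dist_norm subset_iff)
      then have "norm (F i (x + w)) \<le> n" "norm (F i x) \<le> n" using i by (auto simp: K_def)
      then have "norm (F i w) \<le> 2 * real n"
        using norm_triangle_ineq4[of "F i (x + w)" "F i x"] by (simp add: blinfun.add_right)
      moreover have "norm (F i w) = r / norm y * norm (F i y)"
        using r by (simp add: w_def blinfun.scaleR_right)
      ultimately show ?thesis using False r by (simp add: field_simps)
    qed simp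
  qed (use r in auto)
  then show ?thesis by (auto simp: bounded_iff)
qed

section \<open>The convolution hemigroup of a generalized Mehler semigroup\<close>

text \<open>\<open>\<mu> s t\<close> is meant as the law of the increment over the interval from
  \<open>s\<close> to \<open>t\<close>. In \<open>stoch_cont\<close> the length \<delta> works for
  all intervals below the horizon \<open>N\<close> at once; this uniformity is what permits short
  intervals with rational endpoints later.\<close>

locale convolution_hemigroup =
  fixes \<mu> :: "real \<Rightarrow> real \<Rightarrow> 'e::{banach, second_countable_topology} measure"
  assumes prob: "0 \<le> s \<Longrightarrow> s \<le> t \<Longrightarrow> prob_space (\<mu> s t)"
    and sets_\<mu>: "0 \<le> s \<Longrightarrow> s \<le> t \<Longrightarrow> sets (\<mu> s t) = sets borel"
    and conv: "0 \<le> s \<Longrightarrow> s \<le> t \<Longrightarrow> t \<le> u \<Longrightarrow>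
      distr (\<mu> s t \<Otimes>\<^sub>M \<mu> t u) borel (\<lambda>(x, y). x + y) = \<mu> s u"
    and stoch_cont: "0 < e \<Longrightarrow> 0 < \<eta> \<Longrightarrow>
      \<exists>\<delta>>0. \<forall>s t. 0 \<le> s \<and> s \<le> t \<and> t \<le> N \<and> t - s < \<delta> \<longrightarrow> measure (\<mu> s t) {y. e < norm y} \<le> \<eta>"

lemma (in convolution_hemigroup) diag: "0 \<le> s \<Longrightarrow> \<mu> s s = return borel 0"
  by (intro idempotent_measure_eq_return prob sets_\<mu> conv) auto

text \<open>Strong continuity bounds each orbit on a compact interval; uniform boundedness turns
  this into a bound for the operator norms.\<close>

lemma C0_semigroup_bounded:
  fixes T :: "real \<Rightarrow> 'e::banach \<Rightarrow>\<^sub>L 'e"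
  assumes "C0_semigroup T"
  shows "bounded (T ` {0..N})"
proof (rule uniform_boundedness_principle)
  fix x
  have "continuous_on {0..N} (\<lambda>t. T t x)"
    using assms unfolding C0_semigroup_def
    by (meson continuous_on_subset atLeastAtMost_iff atLeast_iff subsetI)
  then show "bounded ((\<lambda>t. T t x) ` {0..N})"
    by (intro compact_imp_bounded compact_continuous_image) auto
qed

lemma Mehler_skew_convolution:
  fixes P :: "real \<Rightarrow> ('e::{banach, second_countable_topology} \<Rightarrow>\<^sub>C real) \<Rightarrow>\<^sub>L ('e \<Rightarrow>\<^sub>C real)"
  assumes M: "generalized_Mehler_semigroup P T \<rho>" and "0 \<le> s" "0 \<le> t"
  shows "distr (\<rho> s \<Otimes>\<^sub>M \<rho> t) borel (\<lambda>(z, y). z + T s y) = \<rho> (s + t)"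
proof -
  have [measurable_cong]: "sets (\<rho> s) = sets borel" "sets (\<rho> t) = sets borel"
    and sets_st: "sets (\<rho> (s + t)) = sets borel"
    and prob: "prob_space (\<rho> s)" "prob_space (\<rho> t)" "prob_space (\<rho> (s + t))"
    using assms by (auto simp: generalized_Mehler_semigroup_def)
  interpret s: prob_space "\<rho> s" by fact
  interpret t: prob_space "\<rho> t" by fact
  interpret st: prob_space "\<rho> (s + t)" by fact
  interpret pair_prob_space "\<rho> s" "\<rho> t" ..
  have [measurable]: "blinfun_apply (T s) \<in> borel_measurable borel"
    by (intro borel_measurable_continuous_onI) (simp add: blinfun.continuous_on)
  let ?h = "\<lambda>(z, y). z + T s y"
  interpret D: prob_space "distr (\<rho> s \<Otimes>\<^sub>M \<rho> t) borel ?h"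
    by (rule P.prob_space_distr) measurable
  show ?thesis
  proof (rule finite_measure_eqI_bcontfun)
    fix f :: "'e \<Rightarrow>\<^sub>C real"
    have int: "integrable (\<rho> s \<Otimes>\<^sub>M \<rho> t) (\<lambda>p. f (?h p))"
      by (rule P.integrable_bcontfun) measurable
    have "(\<integral>x. f x \<partial>distr (\<rho> s \<Otimes>\<^sub>M \<rho> t) borel ?h) = (\<integral>p. f (?h p) \<partial>(\<rho> s \<Otimes>\<^sub>M \<rho> t))"
      by (rule integral_distr) measurable
    also have "\<dots> = (\<integral>y. \<integral>z. f (z + T s y) \<partial>\<rho> s \<partial>\<rho> t)"
      using integral_snd[of "\<lambda>z y. f (z + T s y)"] int by (simp add: split_beta')
    also have "\<dots> = (\<integral>y. P s f y \<partial>\<rho> t)"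
      using M \<open>0 \<le> s\<close> by (simp add: generalized_Mehler_semigroup_def add.commute)
    \<comment> \<open>At the origin \<open>T t 0 = 0\<close>, so the outer operator is plain
      integration against \<open>\<rho> t\<close>.\<close>
    also have "\<dots> = (P t o\<^sub>L P s) f 0"
      using M \<open>0 \<le> t\<close> by (simp add: generalized_Mehler_semigroup_def)
    also have "\<dots> = (\<integral>x. f x \<partial>\<rho> (s + t))"
      using M \<open>0 \<le> s\<close> \<open>0 \<le> t\<close> by (simp add: generalized_Mehler_semigroup_def add.commute)
    finally show "(\<integral>x. f x \<partial>distr (\<rho> s \<Otimes>\<^sub>M \<rho> t) borel ?h) = (\<integral>x. f x \<partial>\<rho> (s + t))" .
  qed (use sets_st in \<open>auto intro: D.finite_measure_axioms st.finite_measure_axioms\<close>)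
qed

lemma Mehler_measure_0:
  fixes P :: "real \<Rightarrow> ('e::{banach, second_countable_topology} \<Rightarrow>\<^sub>C real) \<Rightarrow>\<^sub>L ('e \<Rightarrow>\<^sub>C real)"
  assumes M: "generalized_Mehler_semigroup P T \<rho>"
  shows "\<rho> 0 = return borel 0"
proof (rule idempotent_measure_eq_return)
  have "T 0 = id_blinfun"
    using M by (simp add: generalized_Mehler_semigroup_def C0_semigroup_def)
  then show "distr (\<rho> 0 \<Otimes>\<^sub>M \<rho> 0) borel (\<lambda>(x, y). x + y) = \<rho> 0"
    using Mehler_skew_convolution[OF M, of 0 0] by simp
qed (use M in \<open>auto simp: generalized_Mehler_semigroup_def\<close>)

text \<open>The bounded continuous function \<open>min 1 (norm y / e)\<close> dominates the
  indicator of \<open>{y. e < norm y}\<close> and vanishes at \<open>0\<close>.\<close>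

lemma weakly_tendsto_return_0:
  fixes \<rho> :: "'i \<Rightarrow> 'e::real_normed_vector measure"
  assumes lim: "weakly_tendsto \<rho> (return borel 0) F"
    and \<rho>: "eventually (\<lambda>i. prob_space (\<rho> i) \<and> sets (\<rho> i) = sets borel) F"
    and "0 < e" "0 < \<eta>"
  shows "eventually (\<lambda>i. measure (\<rho> i) {y. e < norm y} < \<eta>) F"
proof -
  have cont: "continuous_on UNIV (\<lambda>y::'e. min 1 (norm y / e))"
    using \<open>0 < e\<close> by (intro continuous_intros) auto
  obtain f :: "'e \<Rightarrow>\<^sub>C real" where f: "apply_bcontfun f = (\<lambda>y. min 1 (norm y / e))"
    by (rule bcontfun_exists[OF cont, of 1]) (use \<open>0 < e\<close> in auto)
  have "((\<lambda>i. \<integral>y. f y \<partial>\<rho> i) \<longlongrightarrow> (\<integral>y. f y \<partial>return borel 0)) F"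
    using lim by (simp add: weakly_tendsto_def)
  moreover have "(\<integral>y. f y \<partial>return borel 0) = 0"
    by (subst integral_return) (auto simp: f)
  ultimately have "eventually (\<lambda>i. (\<integral>y. f y \<partial>\<rho> i) < \<eta>) F"
    using \<open>0 < \<eta>\<close> by (auto intro: order_tendstoD)
  with \<rho> show ?thesis
  proof eventually_elim
    fix i assume i: "prob_space (\<rho> i) \<and> sets (\<rho> i) = sets borel" "(\<integral>y. f y \<partial>\<rho> i) < \<eta>"
    interpret prob_space "\<rho> i" using i by simp
    have [measurable_cong]: "sets (\<rho> i) = sets borel" using i by simp
    have A [measurable]: "{y. e < norm y} \<in> sets borel" by measurable
    then have "measure (\<rho> i) {y. e < norm y} = (\<integral>y. indicator {y. e < norm y} y \<partial>\<rho> i)"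
      using i by (simp add: sets_eq_imp_space_eq[of "\<rho> i" borel])
    also have "\<dots> \<le> (\<integral>y. f y \<partial>\<rho> i)"
    proof (rule integral_mono)
      show "integrable (\<rho> i) (\<lambda>y. f y)" by (rule integrable_bcontfun) measurable
      show "integrable (\<rho> i) (indicator {y. e < norm y} :: _ \<Rightarrow> real)"
        by (intro integrable_const_bound[of _ 1]) auto
    qed (use \<open>0 < e\<close> in \<open>auto simp: f indicator_def\<close>)
    finally show "measure (\<rho> i) {y. e < norm y} < \<eta>" using i by simp
  qed
qed

lemma Mehler_hemigroup:
  fixes P :: "real \<Rightarrow> ('e::{banach, second_countable_topology} \<Rightarrow>\<^sub>C real) \<Rightarrow>\<^sub>L ('e \<Rightarrow>\<^sub>C real)"
  assumes M: "generalized_Mehler_semigroup P T \<rho>"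
    and lim: "weakly_tendsto \<rho> (\<rho> 0) (at 0 within {0..})"
  shows "convolution_hemigroup (\<lambda>s t. distr (\<rho> (t - s)) borel (T s))"
proof -
  have [measurable]: "blinfun_apply (T s) \<in> borel_measurable borel" for s
    by (intro borel_measurable_continuous_onI) (simp add: blinfun.continuous_on)
  have sets: "0 \<le> t \<Longrightarrow> sets (\<rho> t) = sets borel"
    and prob: "0 \<le> t \<Longrightarrow> prob_space (\<rho> t)" for t
    using M by (auto simp: generalized_Mehler_semigroup_def)
  have meas: "blinfun_apply (T s) \<in> borel_measurable (\<rho> t)" if "0 \<le> t" for s t
    using that by (simp add: measurable_cong_sets[OF sets refl])
  note C0 = M[unfolded generalized_Mehler_semigroup_def, THEN conjunct1]
  have semi: "T (a + b) = T a o\<^sub>L T b" if "0 \<le> a" "0 \<le> b" for a b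
    using C0 that by (auto simp: C0_semigroup_def)
  show ?thesis
  proof (rule convolution_hemigroup.intro)
    fix s t :: real assume st: "0 \<le> s" "s \<le> t"
    then show "prob_space (distr (\<rho> (t - s)) borel (T s))"
      by (intro prob_space.prob_space_distr prob meas) auto
    show "sets (distr (\<rho> (t - s)) borel (T s)) = sets borel" by simp
  next
    fix s t u :: real assume *: "0 \<le> s" "s \<le> t" "t \<le> u"
    let ?a = "\<rho> (t - s)" and ?b = "\<rho> (u - t)"
    interpret a: prob_space ?a using * by (intro prob) auto
    interpret b: prob_space ?b using * by (intro prob) auto
    have [measurable_cong]: "sets ?a = sets borel" "sets ?b = sets borel" using * by (simp_all add: sets)
    have D: "prob_space (distr ?b borel (T t))"
      by (rule b.prob_space_distr) measurable
    \<comment> \<open>Since \<open>T s\<close> can be factored out of \<open>T s x + T t y\<close>,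
      the hemigroup relation is the image under \<open>T s\<close> of the skew convolution relation
      for the times \<open>t - s\<close> and \<open>u - t\<close>.\<close>
    have "T t = T s o\<^sub>L T (t - s)"
      using semi[of s "t - s"] * by simp
    then have T: "T t y = T s (T (t - s) y)" for y by simp
    have "distr (distr ?a borel (T s) \<Otimes>\<^sub>M distr ?b borel (T t)) borel (\<lambda>(x, y). x + y)
        = distr (distr (?a \<Otimes>\<^sub>M ?b) (borel \<Otimes>\<^sub>M borel) (\<lambda>(x, y). (T s x, T t y))) borel (\<lambda>(x, y). x + y)"
      using D by (subst pair_measure_distr) (auto intro: prob_space_imp_sigma_finite)
    also have "\<dots> = distr (?a \<Otimes>\<^sub>M ?b) borel (\<lambda>(x, y). T s x + T t y)"
      by (subst distr_distr) (auto simp: comp_def split_beta')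
    also have "\<dots> = distr (?a \<Otimes>\<^sub>M ?b) borel (T s \<circ> (\<lambda>(x, y). x + T (t - s) y))"
      by (intro distr_cong) (auto simp: T blinfun.add_right)
    also have "\<dots> = distr (distr (?a \<Otimes>\<^sub>M ?b) borel (\<lambda>(x, y). x + T (t - s) y)) borel (T s)"
      by (subst distr_distr) auto
    also have "\<dots> = distr (\<rho> (u - s)) borel (T s)"
      using Mehler_skew_convolution[OF M, of "t - s" "u - t"] * by simp
    finally show "distr (distr ?a borel (T s) \<Otimes>\<^sub>M distr ?b borel (T t)) borel (\<lambda>(x, y). x + y)
      = distr (\<rho> (u - s)) borel (T s)" .
  next
    fix e \<eta> N :: real assume e: "0 < e" "0 < \<eta>"
    obtain C where C: "C > 0" "\<And>s. s \<in> {0..N} \<Longrightarrow> norm (T s) \<le> C"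
      using C0_semigroup_bounded[OF C0, of N] unfolding bounded_pos by auto
    \<comment> \<open>If \<open>C\<close> bounds the norm of \<open>T s\<close>, then
      \<open>T s y\<close> can exceed \<open>e\<close> in norm only if \<open>y\<close> exceeds
      \<open>e / C\<close>.\<close>
    have "eventually (\<lambda>h. measure (\<rho> h) {y. e / C < norm y} < \<eta>) (at 0 within {0..})"
    proof (rule weakly_tendsto_return_0)
      show "weakly_tendsto \<rho> (return borel 0) (at 0 within {0..})"
        using lim Mehler_measure_0[OF M] by simp
      show "eventually (\<lambda>h. prob_space (\<rho> h) \<and> sets (\<rho> h) = sets borel) (at 0 within {0..})"
        using prob sets by (auto simp: eventually_at intro!: exI[of _ 1])
    qed (use e C in auto)
    then obtain \<delta> where \<delta>: "\<delta> > 0" "\<And>h. 0 < h \<Longrightarrow> h < \<delta> \<Longrightarrow> measure (\<rho> h) {y. e / C < norm y} < \<eta>"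
      unfolding eventually_at by (auto simp: dist_real_def)
    show "\<exists>\<delta>>0. \<forall>s t. 0 \<le> s \<and> s \<le> t \<and> t \<le> N \<and> t - s < \<delta> \<longrightarrow>
        measure (distr (\<rho> (t - s)) borel (T s)) {y. e < norm y} \<le> \<eta>"
    proof (intro exI[of _ \<delta>] conjI allI impI \<delta>(1))
      fix s t assume st: "0 \<le> s \<and> s \<le> t \<and> t \<le> N \<and> t - s < \<delta>"
      interpret prob_space "\<rho> (t - s)" using st by (intro prob) auto
      have s: "sets (\<rho> (t - s)) = sets borel" using st by (intro sets) auto
      then have [simp]: "space (\<rho> (t - s)) = UNIV" by (auto dest: sets_eq_imp_space_eq)
      have "measure (distr (\<rho> (t - s)) borel (T s)) {y. e < norm y} = measure (\<rho> (t - s)) {y. e < norm (T s y)}"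
        using st by (subst measure_distr) (auto intro!: meas simp: vimage_def)
      also have "\<dots> \<le> measure (\<rho> (t - s)) {y. e / C < norm y}"
      proof (rule finite_measure_mono)
        show "{y. e < norm (T s y)} \<subseteq> {y. e / C < norm y}"
        proof safe
          fix y assume "e < norm (T s y)"
          also have "\<dots> \<le> norm (T s) * norm y" by (rule norm_blinfun)
          also have "\<dots> \<le> C * norm y" using C st by (intro mult_right_mono) auto
          finally show "e / C < norm y" using C by (simp add: field_simps)
        qed
      qed (simp add: s)
      also have "\<dots> \<le> \<eta>"
      \<comment> \<open>The filter \<open>at 0\<close> leaves out \<open>h = 0\<close>; there the
        measure is the point mass at the origin.\<close>
      proof (cases "t = s")
        case True
        have "0 < e / C" using e C by simp
        then show ?thesis
          using True e Mehler_measure_0[OF M] by (simp add: measure_return indicator_def)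
      next
        case False
        then show ?thesis using \<delta>(2)[of "t - s"] st by simp
      qed
      finally show "measure (distr (\<rho> (t - s)) borel (T s)) {y. e < norm y} \<le> \<eta>" .
    qed
  qed
qed

section \<open>Construction of the additive process\<close>

text \<open>The class \<^class>\<open>polish_space\<close> required by \<^locale>\<open>polish_projective\<close> is not implied by its two superclasses
  together, so a dummy real coordinate is attached to move to a type in that class.\<close>

instance prod :: ("{complete_space, second_countable_topology}", "{complete_space, second_countable_topology}") polish_space ..

lemma Kolmogorov_extension:
  fixes P :: "'i set \<Rightarrow> ('i \<Rightarrow> 'a::{complete_space, second_countable_topology}) measure"
  assumes "projective_family I P (\<lambda>_. borel)"
  obtains L where "prob_space L" "sets L = sets (\<Pi>\<^sub>M i\<in>I. borel)"
    "\<And>J. finite J \<Longrightarrow> J \<subseteq> I \<Longrightarrow> distr L (\<Pi>\<^sub>M i\<in>J. borel) (\<lambda>f. restrict f J) = P J"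
proof -
  interpret projective_family I P "\<lambda>_. borel" by fact
  define P' where "P' J = distr (P J) (\<Pi>\<^sub>M i\<in>J. borel) (\<lambda>f. \<lambda>i\<in>J. (f i, 0::real))" for J
  have meas: "(\<lambda>f. \<lambda>i\<in>J. (f i :: 'a, 0::real)) \<in> (\<Pi>\<^sub>M i\<in>J. borel) \<rightarrow>\<^sub>M (\<Pi>\<^sub>M i\<in>J. borel)" for J :: "'i set"
    unfolding borel_prod[symmetric] by measurable
  have meas_fst: "(\<lambda>f. \<lambda>i\<in>J. fst (f i :: 'a \<times> real)) \<in> (\<Pi>\<^sub>M i\<in>K. borel) \<rightarrow>\<^sub>M (\<Pi>\<^sub>M i\<in>J. (borel :: 'a measure))"
    if "J \<subseteq> K" for J K :: "'i set"
  proof (rule measurable_restrict)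
    fix i assume "i \<in> J"
    then have "(\<lambda>f. f i) \<in> (\<Pi>\<^sub>M i\<in>K. borel) \<rightarrow>\<^sub>M (borel \<Otimes>\<^sub>M borel :: ('a \<times> real) measure)"
      using that unfolding borel_prod by (intro measurable_component_singleton) auto
    then show "(\<lambda>f. fst (f i)) \<in> (\<Pi>\<^sub>M i\<in>K. (borel :: ('a \<times> real) measure)) \<rightarrow>\<^sub>M borel"
      unfolding borel_prod[symmetric] by (rule measurable_compose) simp
  qed
  have meas_res: "(\<lambda>f. restrict f J) \<in> (\<Pi>\<^sub>M i\<in>K. borel) \<rightarrow>\<^sub>M (\<Pi>\<^sub>M i\<in>J. borel)"
    if "J \<subseteq> K" for J K :: "'i set"
    using that by (intro measurable_restrict_subset)
  have P'_fst: "distr (P' J) (\<Pi>\<^sub>M i\<in>J. borel) (\<lambda>f. \<lambda>i\<in>J. fst (f i)) = P J" if J: "finite J" "J \<subseteq> I" for J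
  proof -
    note [measurable_cong] = sets_P[OF J]
    have "distr (P' J) (\<Pi>\<^sub>M i\<in>J. borel) (\<lambda>f. \<lambda>i\<in>J. fst (f i)) = distr (P J) (\<Pi>\<^sub>M i\<in>J. borel) (\<lambda>f. f)"
      unfolding P'_def using meas[of J] meas_fst[of J J]
      by (subst distr_distr)
        (auto intro!: distr_cong simp: space_P[OF J] space_PiM PiE_iff extensional_def fun_eq_iff)
    also have "\<dots> = P J"
      by (rule distr_id2) (simp add: sets_P[OF J])
    finally show ?thesis .
  qed
  interpret P': polish_projective I P'
  proof (intro polish_projective.intro projective_family.intro)
    fix J H :: "'i set" assume JH: "J \<subseteq> H" "finite H" "H \<subseteq> I"
    then have J: "finite J" "J \<subseteq> I" by (auto intro: finite_subset)
    let ?a = "\<lambda>J f. \<lambda>i\<in>J. (f i :: 'a, 0 :: real)"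
    have meas_P: "(\<lambda>f. restrict f J) \<in> P H \<rightarrow>\<^sub>M (\<Pi>\<^sub>M i\<in>J. borel)" "?a H \<in> P H \<rightarrow>\<^sub>M (\<Pi>\<^sub>M i\<in>H. borel)"
      using meas_res[OF JH(1)] meas[of H] by (simp_all add: measurable_cong_sets[OF sets_P[OF JH(2,3)] refl])
    have "P' J = distr (distr (P H) (\<Pi>\<^sub>M i\<in>J. borel) (\<lambda>f. restrict f J)) (\<Pi>\<^sub>M i\<in>J. borel) (?a J)"
      unfolding P'_def by (subst P[OF JH]) rule
    also have "\<dots> = distr (P H) (\<Pi>\<^sub>M i\<in>J. borel) (?a J \<circ> (\<lambda>f. restrict f J))"
      by (rule distr_distr[OF meas meas_P(1)])
    also have "\<dots> = distr (P H) (\<Pi>\<^sub>M i\<in>J. borel) ((\<lambda>f. restrict f J) \<circ> ?a H)"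
      using JH(1) by (intro distr_cong) (auto simp: fun_eq_iff)
    also have "\<dots> = distr (P' H) (\<Pi>\<^sub>M i\<in>J. borel) (\<lambda>f. restrict f J)"
      unfolding P'_def by (rule distr_distr[OF meas_res[OF JH(1)] meas_P(2), symmetric])
    finally show "P' J = distr (P' H) (\<Pi>\<^sub>M i\<in>J. borel) (\<lambda>f. restrict f J)" .
  next
    fix J :: "'i set" assume J: "finite J" "J \<subseteq> I"
    note [measurable_cong] = sets_P[OF J]
    show "prob_space (P' J)"
      unfolding P'_def using meas[of J] by (intro prob_space.prob_space_distr prob_space_P J) measurable
  qed
  have lim_res: "distr P'.lim (\<Pi>\<^sub>M i\<in>J. borel) (\<lambda>f. restrict f J) = P' J" if J: "finite J" "J \<subseteq> I" for J
  proof (rule measure_eqI)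
    fix A assume "A \<in> sets (distr P'.lim (\<Pi>\<^sub>M i\<in>J. borel) (\<lambda>f. restrict f J))"
    then have A: "A \<in> sets (\<Pi>\<^sub>M i\<in>J. borel)" by simp
    show "emeasure (distr P'.lim (\<Pi>\<^sub>M i\<in>J. borel) (\<lambda>f. restrict f J)) A = emeasure (P' J) A"
      using emeasure_distr_restrict[OF J(2) P'.sets_lim A] P'.emeasure_lim_emb[OF J(2,1) A] by simp
  qed (simp add: P'.sets_P[OF J])
  let ?L = "distr P'.lim (\<Pi>\<^sub>M i\<in>I. borel) (\<lambda>f. \<lambda>i\<in>I. fst (f i))"
  show ?thesis
  proof
    show "prob_space ?L"
      using meas_fst[of I I] by (intro P'.P.prob_space_distr) (simp add: measurable_cong_sets[OF P'.sets_lim refl])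
    show "sets ?L = sets (\<Pi>\<^sub>M i\<in>I. borel)" by simp
    fix J assume J: "finite J" "J \<subseteq> I"
    note lim_cong = measurable_cong_sets[OF P'.sets_lim refl]
    have "distr ?L (\<Pi>\<^sub>M i\<in>J. borel) (\<lambda>f. restrict f J)
        = distr P'.lim (\<Pi>\<^sub>M i\<in>J. borel) ((\<lambda>f. restrict f J) \<circ> (\<lambda>f. \<lambda>i\<in>I. fst (f i)))"
      by (rule distr_distr[OF meas_res[OF J(2)]]) (subst lim_cong, rule meas_fst[OF order_refl])
    also have "\<dots> = distr P'.lim (\<Pi>\<^sub>M i\<in>J. borel) ((\<lambda>f. \<lambda>i\<in>J. fst (f i)) \<circ> (\<lambda>f. restrict f J))"
      using J(2) by (intro distr_cong) (auto simp: fun_eq_iff)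
    also have "\<dots> = distr (distr P'.lim (\<Pi>\<^sub>M i\<in>J. borel) (\<lambda>f. restrict f J)) (\<Pi>\<^sub>M i\<in>J. borel) (\<lambda>f. \<lambda>i\<in>J. fst (f i))"
      by (rule distr_distr[symmetric, OF meas_fst[OF order_refl]]) (subst lim_cong, rule meas_res[OF J(2)])
    also have "\<dots> = P J"
      unfolding lim_res[OF J] by (rule P'_fst[OF J])
    finally show "distr ?L (\<Pi>\<^sub>M i\<in>J. borel) (\<lambda>f. restrict f J) = P J" .
  qed
qed

section \<open>Independence and finite-dimensional distributions\<close>

lemma (in prob_space) distr_indep_add:
  fixes X Y :: "'a \<Rightarrow> 'b::{real_normed_vector, second_countable_topology}"
  assumes "indep_var borel X borel Y"
  shows "distr M borel (\<lambda>\<omega>. X \<omega> + Y \<omega>) = distr (distr M borel X \<Otimes>\<^sub>M distr M borel Y) borel (\<lambda>(x, y). x + y)"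
proof -
  have [measurable]: "X \<in> borel_measurable M" "Y \<in> borel_measurable M"
    and eq: "distr M borel X \<Otimes>\<^sub>M distr M borel Y = distr M (borel \<Otimes>\<^sub>M borel) (\<lambda>\<omega>. (X \<omega>, Y \<omega>))"
    using assms by (auto simp: indep_var_distribution_eq)
  show ?thesis
    unfolding eq by (subst distr_distr) (auto simp: comp_def)
qed

lemma indep_vars_PiM_components:
  fixes N :: "'i \<Rightarrow> 'b::topological_space measure"
  assumes "finite H" and N: "\<And>i. i \<in> H \<Longrightarrow> prob_space (N i)" "\<And>i. i \<in> H \<Longrightarrow> sets (N i) = sets borel"
  shows "prob_space.indep_vars (PiM H N) (\<lambda>_. borel) (\<lambda>i \<omega>. \<omega> i) H"
    and "\<And>i. i \<in> H \<Longrightarrow> distr (PiM H N) borel (\<lambda>\<omega>. \<omega> i) = N i"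
proof -
  interpret prob_space "PiM H N" using N by (intro prob_space_PiM)
  have sets: "sets (PiM H N) = sets (\<Pi>\<^sub>M i\<in>H. borel)" using N(2) by (intro sets_PiM_cong) auto
  have comp: "(\<lambda>\<omega>. \<omega> i) \<in> borel_measurable (PiM H N)" if "i \<in> H" for i
    using that by (subst measurable_cong_sets[OF sets refl]) (rule measurable_component_singleton)
  show D: "distr (PiM H N) borel (\<lambda>\<omega>. \<omega> i) = N i" if "i \<in> H" for i
    using distr_PiM_component[of H N i] N that by (simp cong: distr_cong)
  show "indep_vars (\<lambda>_. borel) (\<lambda>i \<omega>. \<omega> i) H"
  proof (cases "H = {}")
    case True
    then show ?thesis unfolding indep_vars_def indep_sets_def by simp
  next
    case False
    have "distr (PiM H N) (\<Pi>\<^sub>M i\<in>H. borel) (\<lambda>x. \<lambda>i\<in>H. x i) = distr (PiM H N) (\<Pi>\<^sub>M i\<in>H. borel) (\<lambda>x. x)"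
      by (intro distr_cong) (auto simp: space_PiM PiE_iff extensional_def fun_eq_iff)
    also have "\<dots> = PiM H N" by (rule distr_id2) (simp add: sets)
    also have "\<dots> = (\<Pi>\<^sub>M i\<in>H. distr (PiM H N) borel (\<lambda>\<omega>. \<omega> i))"
      using D by (intro PiM_cong) auto
    finally show ?thesis
      using False comp by (subst indep_vars_iff_distr_eq_PiM') auto
  qed
qed

definition pre :: "real set \<Rightarrow> real \<Rightarrow> real" where
  "pre J s = Max (insert 0 {r\<in>J. r < s})"

lemma pre_nonneg: "finite J \<Longrightarrow> 0 \<le> pre J s"
  by (simp add: pre_def)

lemma pre_le: "finite J \<Longrightarrow> 0 \<le> s \<Longrightarrow> pre J s \<le> s"
  by (simp add: pre_def)

lemma prob_space_PiM_empty_eq: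
  assumes "prob_space M" "prob_space N" "sets M = sets (PiM {} A)" "sets N = sets (PiM {} A)"
  shows "M = N"
proof (rule measure_eqI)
  interpret M: prob_space M by fact
  interpret N: prob_space N by fact
  have "space M = {\<lambda>_. undefined}" "space N = {\<lambda>_. undefined}"
    using assms(3,4)[THEN sets_eq_imp_space_eq] by (auto simp: space_PiM_empty)
  then have 1: "emeasure M {\<lambda>_. undefined} = 1" "emeasure N {\<lambda>_. undefined} = 1"
    using M.emeasure_space_1 N.emeasure_space_1 by auto
  fix X assume "X \<in> sets M"
  then have "X = {} \<or> X = {\<lambda>_. undefined}"
    using assms(3) by (auto simp: sets_PiM_empty)
  with 1 show "emeasure M X = emeasure N X" by auto
qed (use assms in auto)

context convolution_hemigroup
begin

text \<open>Coordinate \<open>s\<close> stands for the increment over the gap that ends at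
  \<open>s\<close>. Indexing gaps by their right ends makes the value at \<open>t\<close> the sum of
  the coordinates up to \<open>t\<close>.\<close>

definition incr_law :: "real set \<Rightarrow> (real \<Rightarrow> 'e) measure" where
  "incr_law J = (\<Pi>\<^sub>M s\<in>J. \<mu> (pre J s) s)"

definition fdd :: "real set \<Rightarrow> (real \<Rightarrow> 'e) measure" where
  "fdd J = distr (incr_law J) (\<Pi>\<^sub>M t\<in>J. borel) (\<lambda>\<xi>. \<lambda>t\<in>J. \<Sum>s\<in>{s\<in>J. s \<le> t}. \<xi> s)"

lemma
  assumes J: "finite J" "J \<subseteq> {0..}"
  shows prob_incr_law: "prob_space (incr_law J)"
    and sets_incr_law: "sets (incr_law J) = sets (\<Pi>\<^sub>M s\<in>J. borel)"
    and indep_incr_law: "prob_space.indep_vars (incr_law J) (\<lambda>_. borel) (\<lambda>s \<xi>. \<xi> s) J"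
    and distr_incr_law: "\<And>s. s \<in> J \<Longrightarrow> distr (incr_law J) borel (\<lambda>\<xi>. \<xi> s) = \<mu> (pre J s) s"
proof -
  have *: "prob_space (\<mu> (pre J s) s)" "sets (\<mu> (pre J s) s) = sets borel" if "s \<in> J" for s
    using that J by (auto intro!: prob sets_\<mu> pre_nonneg pre_le)
  show "prob_space (incr_law J)" unfolding incr_law_def by (intro prob_space_PiM *)
  show "sets (incr_law J) = sets (\<Pi>\<^sub>M s\<in>J. borel)"
    unfolding incr_law_def by (intro sets_PiM_cong *) auto
  show "prob_space.indep_vars (incr_law J) (\<lambda>_. borel) (\<lambda>s \<xi>. \<xi> s) J"
    "\<And>s. s \<in> J \<Longrightarrow> distr (incr_law J) borel (\<lambda>\<xi>. \<xi> s) = \<mu> (pre J s) s"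
    unfolding incr_law_def using indep_vars_PiM_components[OF J(1) *] by auto
qed

lemma measurable_partial_sums:
  "finite J \<Longrightarrow> J \<subseteq> {0..} \<Longrightarrow>
    (\<lambda>\<xi>. \<lambda>t\<in>J. \<Sum>s\<in>{s\<in>J. s \<le> t}. \<xi> s) \<in> incr_law J \<rightarrow>\<^sub>M (\<Pi>\<^sub>M t\<in>J. borel)"
  by (subst measurable_cong_sets[OF sets_incr_law refl])
    (auto intro!: measurable_restrict borel_measurable_sum measurable_component_singleton)

text \<open>Forgetting \<open>u\<close> merges the gap ending at \<open>u\<close> with the next one.
  The two increments are independent, so by \<open>conv\<close> their sum has the law prescribed for
  the merged gap; if no time of \<open>J\<close> follows \<open>u\<close>, its increment is simply
  dropped.\<close>

lemma fdd_remove: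
  assumes J: "finite J" "J \<subseteq> {0..}" and u: "0 \<le> u" "u \<notin> J"
  shows "fdd J = distr (fdd (insert u J)) (\<Pi>\<^sub>M t\<in>J. borel) (\<lambda>f. restrict f J)"
proof -
  let ?H = "insert u J"
  have H: "finite ?H" "?H \<subseteq> {0..}" using J u by auto
  interpret prob_space "incr_law ?H" by (rule prob_incr_law[OF H])
  have comp: "(\<lambda>\<xi>. \<xi> s) \<in> borel_measurable (incr_law ?H)" if "s \<in> ?H" for s
    using that by (subst measurable_cong_sets[OF sets_incr_law[OF H] refl]) (rule measurable_component_singleton)
  \<comment> \<open>\<open>K s\<close> consists of the gaps of \<open>?H\<close> that make up the
    gap of \<open>J\<close> ending at \<open>s\<close>: it is \<open>{u, s}\<close> if
    \<open>u\<close> falls into that gap and \<open>{s}\<close> otherwise.\<close>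
  define K where "K s = {r\<in>?H. r = s \<or> r = u \<and> u < s \<and> (\<forall>j\<in>J. j < s \<longrightarrow> j < u)}" for s
  have K_sub: "K s \<subseteq> ?H" and K_fin: "finite (K s)" for s
    using J by (auto simp: K_def)
  have K_disj: "disjoint_family_on K J"
    unfolding disjoint_family_on_def
  proof (intro ballI impI)
    fix a b assume "a \<in> J" "b \<in> J" "a \<noteq> b"
    then show "K a \<inter> K b = {}"
      using u(2) by (cases a b rule: linorder_cases) (auto simp: K_def)
  qed
  have K_cover: "(\<Union>s\<in>{s\<in>J. s \<le> t}. K s) = {r\<in>?H. r \<le> t}" if t: "t \<in> J" for t
  proof (intro equalityI subsetI)
    fix r assume "r \<in> {r\<in>?H. r \<le> t}"
    then consider "r \<in> J" "r \<le> t" | "r = u" "u < t" using t u(2) by force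
    then show "r \<in> (\<Union>s\<in>{s\<in>J. s \<le> t}. K s)"
    proof cases
      case 1
      then show ?thesis by (auto simp: K_def)
    next
      case 2
      define s where "s = Min {j\<in>J. u < j}"
      have "finite {j\<in>J. u < j}" "{j\<in>J. u < j} \<noteq> {}" using J t 2 by auto
      then have s: "s \<in> J" "u < s" "\<And>j. j \<in> J \<Longrightarrow> u < j \<Longrightarrow> s \<le> j"
        using Min_in[of "{j\<in>J. u < j}"] by (auto simp: s_def)
      have "j < u" if "j \<in> J" "j < s" for j
        using s(3)[OF that(1)] that u(2) by (cases j u rule: linorder_cases) auto
      with s 2 t show ?thesis by (auto simp: K_def intro!: bexI[of _ s])
    qed
  qed (auto simp: K_def)
  define \<eta> where "\<eta> s \<xi> = (\<Sum>r\<in>K s. \<xi> r)" for s and \<xi> :: "real \<Rightarrow> 'e"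
  have \<eta>_meas: "\<eta> s \<in> borel_measurable (incr_law ?H)" for s
    unfolding \<eta>_def using K_sub by (intro borel_measurable_sum comp) auto
  have \<eta>_indep: "indep_vars (\<lambda>_. borel) \<eta> J"
  proof -
    have "indep_vars (\<lambda>_. borel) (\<lambda>s \<xi>. \<Sum>r\<in>K s. (restrict (\<lambda>i. \<xi> i) (K s)) r) J"
      by (rule indep_vars_compose2[OF indep_vars_restrict[OF indep_incr_law[OF H] K_sub K_disj]])
        (auto intro!: borel_measurable_sum measurable_component_singleton)
    then show ?thesis by (simp add: \<eta>_def[abs_def])
  qed
  have \<eta>_law: "distr (incr_law ?H) borel (\<eta> s) = \<mu> (pre J s) s" if s: "s \<in> J" for s
  proof (cases "u \<in> K s")
    case True
    then have us: "u < s" "\<And>j. j \<in> J \<Longrightarrow> j < s \<Longrightarrow> j < u" using u(2) s by (auto simp: K_def)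
    then have "K s = {u, s}" using s by (auto simp: K_def)
    then have \<eta>: "\<eta> s = (\<lambda>\<xi>. \<xi> u + \<xi> s)" using us by (auto simp: \<eta>_def)
    have below_u: "{r\<in>?H. r < u} = {r\<in>J. r < s}"
      by (auto simp: less_trans[OF _ us(1)] us(2))
    have below_s: "{r\<in>?H. r < s} = insert u {r\<in>J. r < u}"
      by (auto simp: us(1) less_trans[OF _ us(1)] us(2))
    have pre: "pre ?H u = pre J s" "pre ?H s = u"
      unfolding pre_def below_u below_s using J u by (auto intro!: Max_eqI simp del: Max_insert)
    have "indep_var borel (\<lambda>\<xi>. \<xi> u) borel (\<lambda>\<xi>. \<xi> s)"
    proof -
      have "indep_var borel ((\<lambda>f. f u) \<circ> (\<lambda>\<xi>. restrict (\<lambda>i. \<xi> i) {u})) borel ((\<lambda>f. f s) \<circ> (\<lambda>\<xi>. restrict (\<lambda>i. \<xi> i) {s}))"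
        using s us by (intro indep_var_compose[OF indep_var_restrict[OF indep_incr_law[OF H]]])
          (auto intro!: measurable_component_singleton)
      then show ?thesis by (simp add: comp_def)
    qed
    from distr_indep_add[OF this]
    have "distr (incr_law ?H) borel (\<eta> s) = distr (\<mu> (pre ?H u) u \<Otimes>\<^sub>M \<mu> (pre ?H s) s) borel (\<lambda>(x, y). x + y)"
      using s by (simp add: \<eta> distr_incr_law[OF H])
    also have "\<dots> = \<mu> (pre J s) s"
      using conv[of "pre ?H u" u s] us pre pre_nonneg[OF H(1), of u] pre_le[OF H(1) u(1)] by simp
    finally show ?thesis .
  next
    case False
    then have "K s = {s}" using s u(2) by (auto simp: K_def)
    then have \<eta>: "\<eta> s = (\<lambda>\<xi>. \<xi> s)" by (auto simp: \<eta>_def)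
    have "pre ?H s = pre J s"
    proof (cases "u < s")
      case True
      then obtain j where j: "j \<in> J" "j < s" "u < j"
        using False u(2) by (auto simp: K_def not_less) (metis order_le_imp_less_or_eq)
      have below: "{r\<in>?H. r < s} = insert u {r\<in>J. r < s}" using True by auto
      have "pre ?H s = max u (Max (insert 0 {r\<in>J. r < s}))"
        unfolding pre_def below insert_commute[of 0 u] using J by (intro Max_insert) auto
      moreover have "j \<le> Max (insert 0 {r\<in>J. r < s})" using j J by (intro Max_ge) auto
      ultimately show ?thesis using j by (simp add: pre_def)
    next
      case False
      then have "{r\<in>?H. r < s} = {r\<in>J. r < s}" by auto
      then show ?thesis by (simp add: pre_def)
    qed
    then show ?thesis using s by (simp add: \<eta> distr_incr_law[OF H])
  qed
  have law: "distr (incr_law ?H) (\<Pi>\<^sub>M t\<in>J. borel) (\<lambda>\<xi>. \<lambda>s\<in>J. \<eta> s \<xi>) = incr_law J"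
  proof (cases "J = {}")
    case True
    show ?thesis
    proof (rule prob_space_PiM_empty_eq[where A = "\<lambda>_. borel"])
      show "prob_space (distr (incr_law ?H) (\<Pi>\<^sub>M t\<in>J. borel) (\<lambda>\<xi>. \<lambda>s\<in>J. \<eta> s \<xi>))"
        by (intro prob_space_distr measurable_restrict \<eta>_meas)
    qed (use prob_incr_law[OF J] sets_incr_law[OF J] True in auto)
  next
    case False
    with \<eta>_indep \<eta>_meas have "distr (incr_law ?H) (\<Pi>\<^sub>M t\<in>J. borel) (\<lambda>\<xi>. \<lambda>s\<in>J. \<eta> s \<xi>)
        = (\<Pi>\<^sub>M s\<in>J. distr (incr_law ?H) borel (\<eta> s))"
      by (subst (asm) indep_vars_iff_distr_eq_PiM') auto
    also have "\<dots> = incr_law J"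
      unfolding incr_law_def[of J] using \<eta>_law by (intro PiM_cong) auto
    finally show ?thesis .
  qed
  have sum_eq: "(\<Sum>s\<in>{s\<in>J. s \<le> t}. \<eta> s \<xi>) = (\<Sum>r\<in>{r\<in>?H. r \<le> t}. \<xi> r)" if "t \<in> J" for t \<xi>
    unfolding \<eta>_def K_cover[OF that, symmetric]
    using J K_fin K_disj by (intro sum.UNION_disjoint[symmetric]) (auto simp: disjoint_family_on_def)
  have "fdd J = distr (distr (incr_law ?H) (\<Pi>\<^sub>M t\<in>J. borel) (\<lambda>\<xi>. \<lambda>s\<in>J. \<eta> s \<xi>)) (\<Pi>\<^sub>M t\<in>J. borel)
      (\<lambda>\<xi>. \<lambda>t\<in>J. \<Sum>s\<in>{s\<in>J. s \<le> t}. \<xi> s)"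
    unfolding law fdd_def ..
  also have "\<dots> = distr (incr_law ?H) (\<Pi>\<^sub>M t\<in>J. borel) (\<lambda>\<xi>. \<lambda>t\<in>J. \<Sum>r\<in>{r\<in>?H. r \<le> t}. \<xi> r)"
  proof (subst distr_distr)
    have "(\<Sum>s\<in>{s\<in>J. s \<le> t}. (\<lambda>s\<in>J. \<eta> s \<xi>) s) = (\<Sum>r\<in>{r\<in>?H. r \<le> t}. \<xi> r)" if "t \<in> J" for t \<xi>
      unfolding sum_eq[OF that, symmetric] by (rule sum.cong) auto
    then show "distr (incr_law ?H) (\<Pi>\<^sub>M t\<in>J. borel)
        ((\<lambda>\<xi>. \<lambda>t\<in>J. \<Sum>s\<in>{s\<in>J. s \<le> t}. \<xi> s) \<circ> (\<lambda>\<xi>. \<lambda>s\<in>J. \<eta> s \<xi>))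
      = distr (incr_law ?H) (\<Pi>\<^sub>M t\<in>J. borel) (\<lambda>\<xi>. \<lambda>t\<in>J. \<Sum>r\<in>{r\<in>?H. r \<le> t}. \<xi> r)"
      by (intro distr_cong) (auto simp: fun_eq_iff)
  qed (use J in \<open>auto intro!: measurable_restrict \<eta>_meas borel_measurable_sum measurable_component_singleton\<close>)
  also have "\<dots> = distr (fdd ?H) (\<Pi>\<^sub>M t\<in>J. borel) (\<lambda>f. restrict f J)"
    unfolding fdd_def
    by (subst distr_distr[OF _ measurable_partial_sums[OF H]])
      (auto intro!: distr_cong measurable_restrict_subset simp: fun_eq_iff)
  finally show ?thesis .
qed

lemma prob_fdd: "finite J \<Longrightarrow> J \<subseteq> {0..} \<Longrightarrow> prob_space (fdd J)"
  unfolding fdd_def by (intro prob_space.prob_space_distr prob_incr_law measurable_partial_sums)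

text \<open>Consistency is needed for arbitrary finite \<open>J \<subseteq> H\<close>; it follows by
  removing the times of \<open>H - J\<close> one by one.\<close>

lemma projective_family_fdd: "projective_family {0..} fdd (\<lambda>_. borel)"
proof (rule projective_family.intro)
  fix J H :: "real set" assume JH: "J \<subseteq> H" "finite H" "H \<subseteq> {0..}"
  have "fdd J = distr (fdd (J \<union> D)) (\<Pi>\<^sub>M i\<in>J. borel) (\<lambda>f. restrict f J)"
    if "finite D" "D \<inter> J = {}" "D \<subseteq> H" for D
    using that
  proof (induction D)
    case empty
    have "distr (fdd J) (\<Pi>\<^sub>M i\<in>J. borel) (\<lambda>f. restrict f J) = distr (fdd J) (\<Pi>\<^sub>M i\<in>J. borel) (\<lambda>f. f)"
      by (intro distr_cong) (auto simp: fdd_def space_PiM PiE_iff extensional_def fun_eq_iff)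
    also have "\<dots> = fdd J" by (rule distr_id2) (simp add: fdd_def)
    finally show ?case by (simp only: Un_empty_right)
  next
    case (insert u D)
    have *: "fdd (J \<union> D) = distr (fdd (insert u (J \<union> D))) (\<Pi>\<^sub>M t\<in>J \<union> D. borel) (\<lambda>f. restrict f (J \<union> D))"
      using insert JH by (intro fdd_remove) (auto intro: finite_subset)
    have meas: "(\<lambda>f. restrict f (J \<union> D)) \<in> fdd (insert u (J \<union> D)) \<rightarrow>\<^sub>M (\<Pi>\<^sub>M t\<in>J \<union> D. borel)"
      by (subst measurable_cong_sets[of _ "\<Pi>\<^sub>M t\<in>insert u (J \<union> D). borel"])
        (auto simp: fdd_def intro!: measurable_restrict_subset)
    have "fdd J = distr (fdd (J \<union> D)) (\<Pi>\<^sub>M i\<in>J. borel) (\<lambda>f. restrict f J)"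
      using insert.IH insert.prems by blast
    also have "\<dots> = distr (fdd (insert u (J \<union> D))) (\<Pi>\<^sub>M i\<in>J. borel) (\<lambda>f. restrict f J)"
      unfolding * by (subst distr_distr[OF _ meas])
        (auto intro!: distr_cong measurable_restrict_subset simp: fun_eq_iff)
    finally show ?case by (simp only: Un_insert_right)
  qed
  from this[of "H - J"] JH show "fdd J = distr (fdd H) (\<Pi>\<^sub>M i\<in>J. borel) (\<lambda>f. restrict f J)"
    by (auto simp: Un_absorb1)
qed (rule prob_fdd)

end

locale additive_process = convolution_hemigroup \<mu> + prob_space M
  for \<mu> :: "real \<Rightarrow> real \<Rightarrow> 'e::{banach, second_countable_topology} measure" and M :: "'w measure" +
  fixes X :: "real \<Rightarrow> 'w \<Rightarrow> 'e"
  assumes X_measurable: "0 \<le> t \<Longrightarrow> X t \<in> borel_measurable M"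
    and X_start: "AE \<omega> in M. X 0 \<omega> = 0"
    and X_increment: "0 \<le> s \<Longrightarrow> s \<le> t \<Longrightarrow> distr M borel (\<lambda>\<omega>. X t \<omega> - X s \<omega>) = \<mu> s t"
    and X_indep: "independent_increments M X"

lemma partial_sums_diff:
  fixes \<xi> :: "'i::linorder \<Rightarrow> 'b::ab_group_add"
  assumes "finite J" "s \<in> J" "t \<in> J" "s \<le> t"
  shows "(\<lambda>t\<in>J. \<Sum>r\<in>{r\<in>J. r \<le> t}. \<xi> r) t - (\<lambda>t\<in>J. \<Sum>r\<in>{r\<in>J. r \<le> t}. \<xi> r) s
    = (\<Sum>r\<in>{r\<in>J. s < r \<and> r \<le> t}. \<xi> r)"
proof -
  have "{r\<in>J. r \<le> t} = {r\<in>J. r \<le> s} \<union> {r\<in>J. s < r \<and> r \<le> t}" using assms(4) by auto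
  moreover have "sum \<xi> ({r\<in>J. r \<le> s} \<union> {r\<in>J. s < r \<and> r \<le> t})
      = sum \<xi> {r\<in>J. r \<le> s} + sum \<xi> {r\<in>J. s < r \<and> r \<le> t}"
    using assms(1) by (intro sum.union_disjoint) auto
  ultimately show ?thesis using assms by simp
qed

lemma (in convolution_hemigroup) additive_process_exists:
  obtains L where "additive_process \<mu> L (\<lambda>t \<omega>. \<omega> t)"
proof -
  obtain L where prob_L: "prob_space L" and sets_L: "sets L = sets (\<Pi>\<^sub>M t\<in>{0..}. borel)"
    and L_fdd: "\<And>J. finite J \<Longrightarrow> J \<subseteq> {0..} \<Longrightarrow> distr L (\<Pi>\<^sub>M t\<in>J. borel) (\<lambda>f. restrict f J) = fdd J"
    using Kolmogorov_extension[OF projective_family_fdd] by metis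
  interpret L: prob_space L by fact
  let ?S = "\<lambda>J \<xi>. \<lambda>t\<in>J. \<Sum>s\<in>{s\<in>J. s \<le> t}. \<xi> s :: 'e"
  \<comment> \<open>Any quantity that depends on finitely many times may be computed under
    \<open>incr_law J\<close>, where increments are sums of independent coordinates.\<close>
  have transfer: "distr L N g = distr (incr_law J) N (f \<circ> ?S J)"
    if J: "finite J" "J \<subseteq> {0..}" and f: "f \<in> (\<Pi>\<^sub>M t\<in>J. borel) \<rightarrow>\<^sub>M N"
      and g: "\<And>\<omega>. f (restrict \<omega> J) = g \<omega>" for J N f g
  proof -
    have "distr L N g = distr L N (f \<circ> (\<lambda>\<omega>. restrict \<omega> J))"
      by (intro distr_cong) (auto simp: g)
    also have "\<dots> = distr (fdd J) N f"
      unfolding L_fdd[OF J, symmetric]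
      by (intro distr_distr[symmetric] f, subst measurable_cong_sets[OF sets_L refl])
        (intro measurable_restrict_subset J)
    also have "\<dots> = distr (incr_law J) N (f \<circ> ?S J)"
      unfolding fdd_def by (intro distr_distr f measurable_partial_sums J)
    finally show ?thesis .
  qed
  have meas: "(\<lambda>\<omega>. \<omega> t) \<in> borel_measurable L" if "0 \<le> t" for t
    using that by (subst measurable_cong_sets[OF sets_L refl]) (intro measurable_component_singleton, simp)
  have incr: "distr L borel (\<lambda>\<omega>. \<omega> t - \<omega> s) = \<mu> s t" if st: "0 \<le> s" "s \<le> t" for s t
  \<comment> \<open>For \<open>s = t\<close> the set \<open>{s, t}\<close> is a singleton and
    \<open>pre\<close> would return \<open>0\<close> in place of \<open>s\<close>; the increment is
    identically zero there, which agrees with \<open>diag\<close>.\<close>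
  proof (cases "s = t")
    case True
    with st True show ?thesis by (simp add: diag)
  next
    case False
    let ?J = "{s, t}"
    have J: "finite ?J" "?J \<subseteq> {0..}" using st by auto
    have "distr L borel (\<lambda>\<omega>. \<omega> t - \<omega> s) = distr (incr_law ?J) borel ((\<lambda>\<omega>. \<omega> t - \<omega> s) \<circ> ?S ?J)"
      by (rule transfer[OF J]) (auto intro!: borel_measurable_diff measurable_component_singleton)
    also have "(\<lambda>\<omega>. \<omega> t - \<omega> s) \<circ> ?S ?J = (\<lambda>\<xi>. \<xi> t)"
    proof -
      have "{r \<in> ?J. s < r \<and> r \<le> t} = {t}" using st False by auto
      then show ?thesis
        using partial_sums_diff[of ?J s t] st by (auto simp: fun_eq_iff comp_def)
    qed
    also have "distr (incr_law ?J) borel (\<lambda>\<xi>. \<xi> t) = \<mu> (pre ?J t) t"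
      using J by (intro distr_incr_law) auto
    also have "pre ?J t = s"
    proof -
      have "{r \<in> ?J. r < t} = {s}" using st False by auto
      then show ?thesis using st by (simp add: pre_def)
    qed
    finally show ?thesis .
  qed
  have start: "AE \<omega> in L. \<omega> 0 = 0"
  proof -
    have J: "finite {0::real}" "{0::real} \<subseteq> {0..}" by auto
    have "distr L borel (\<lambda>\<omega>. \<omega> 0) = distr (incr_law {0}) borel ((\<lambda>\<omega>. \<omega> 0) \<circ> ?S {0})"
      by (rule transfer[OF J]) (auto intro!: measurable_component_singleton)
    also have "(\<lambda>\<omega>. \<omega> 0) \<circ> ?S {0::real} = (\<lambda>\<xi>. \<xi> 0)"
    proof -
      have "{r \<in> {0::real}. r \<le> 0} = {0}" by auto
      then show ?thesis by (simp add: fun_eq_iff)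
    qed
    also have "distr (incr_law {0}) borel (\<lambda>\<xi>. \<xi> 0) = \<mu> (pre {0} 0) 0"
      using J by (intro distr_incr_law) auto
    also have "\<dots> = return borel 0"
    proof -
      have "pre {0} 0 = 0" by (rule antisym) (rule pre_le pre_nonneg; simp)+
      then show ?thesis by (simp add: diag)
    qed
    finally have law: "distr L borel (\<lambda>\<omega>. \<omega> 0) = return borel (0 :: 'e)" .
    have "AE x in distr L borel (\<lambda>\<omega>. \<omega> 0). x = (0::'e)"
      unfolding law by (subst AE_return) auto
    then show ?thesis using meas[of 0] by (subst (asm) AE_distr_iff) auto
  qed
  have indep: "independent_increments L (\<lambda>t \<omega>. \<omega> t)"
    unfolding independent_increments_def
  proof (intro allI impI, elim conjE)
    fix n and t :: "nat \<Rightarrow> real" assume t0: "0 \<le> t 0" and t_step: "\<forall>i<n. t i \<le> t (Suc i)"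
    have mono: "t i \<le> t j" if "i \<le> j" "j \<le> n" for i j
      using that
    proof (induction j rule: dec_induct)
      case (step j)
      then show ?case using t_step[rule_format, of j] by simp
    qed simp
    have t_nonneg: "0 \<le> t i" if "i \<le> n" for i
      using mono[of 0 i] t0 that by simp
    let ?inc = "\<lambda>i \<omega>. \<omega> (t (Suc i)) - \<omega> (t i) :: 'e"
    show "L.indep_vars (\<lambda>_. borel) ?inc {..<n}"
    proof (cases "n = 0")
      case True
      then show ?thesis unfolding L.indep_vars_def L.indep_sets_def by simp
    next
      case False
      define J where "J = t ` {..n}"
      have J: "finite J" "J \<subseteq> {0..}" using t_nonneg by (auto simp: J_def)
      have tJ: "t i \<in> J" if "i \<le> n" for i using that by (auto simp: J_def)
      interpret I: prob_space "incr_law J" by (rule prob_incr_law[OF J])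
      \<comment> \<open>Repeated times collapse in \<open>J\<close> and yield an empty block, that
        is, a zero increment. The half-open blocks are disjoint although \<open>t\<close> is only
        weakly increasing.\<close>
      define K where "K i = {r\<in>J. t i < r \<and> r \<le> t (Suc i)}" for i
      have K_disj: "disjoint_family_on K {..<n}"
        unfolding disjoint_family_on_def
      proof (intro ballI impI)
        fix i j assume "i \<in> {..<n}" "j \<in> {..<n}" "i \<noteq> j"
        then show "K i \<inter> K j = {}"
        proof (induction i j rule: linorder_wlog)
          case (le i j)
          then have "t (Suc i) \<le> t j" by (intro mono) auto
          then show ?case by (auto simp: K_def)
        qed auto
      qed
      have incS: "?inc i \<circ> ?S J = (\<lambda>\<xi>. \<Sum>r\<in>K i. \<xi> r)" if "i < n" for i
        using partial_sums_diff[OF J(1) tJ[of i] tJ[of "Suc i"]] that t_step by (auto simp: K_def fun_eq_iff)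
      have I_indep: "I.indep_vars (\<lambda>_. borel) (\<lambda>i \<xi>. \<Sum>r\<in>K i. \<xi> r) {..<n}"
      proof -
        have "I.indep_vars (\<lambda>_. borel) (\<lambda>i \<xi>. \<Sum>r\<in>K i. (restrict (\<lambda>s. \<xi> s) (K i)) r) {..<n}"
          by (rule I.indep_vars_compose2[OF I.indep_vars_restrict[OF indep_incr_law[OF J] _ K_disj]])
            (auto simp: K_def intro!: borel_measurable_sum measurable_component_singleton)
        then show ?thesis by simp
      qed
      have inc_meas: "?inc i \<in> (\<Pi>\<^sub>M t\<in>J. borel) \<rightarrow>\<^sub>M borel" if "i < n" for i
        using that by (intro borel_measurable_diff measurable_component_singleton tJ) auto
      have one: "distr L borel (?inc i) = distr (incr_law J) borel (\<lambda>\<xi>. \<Sum>r\<in>K i. \<xi> r)" if "i < n" for i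
        unfolding incS[OF that, symmetric] using that
        by (intro transfer[OF J]) (auto intro!: inc_meas simp: tJ)
      have "distr L (\<Pi>\<^sub>M i\<in>{..<n}. borel) (\<lambda>\<omega>. \<lambda>i\<in>{..<n}. ?inc i \<omega>)
          = distr (incr_law J) (\<Pi>\<^sub>M i\<in>{..<n}. borel) ((\<lambda>\<omega>. \<lambda>i\<in>{..<n}. ?inc i \<omega>) \<circ> ?S J)"
        by (intro transfer[OF J]) (auto intro!: measurable_restrict inc_meas simp: tJ fun_eq_iff)
      also have "(\<lambda>\<omega>. \<lambda>i\<in>{..<n}. ?inc i \<omega>) \<circ> ?S J = (\<lambda>\<xi>. \<lambda>i\<in>{..<n}. \<Sum>r\<in>K i. \<xi> r)"
        using incS by (auto simp: fun_eq_iff comp_def)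
      also have "distr (incr_law J) (\<Pi>\<^sub>M i\<in>{..<n}. borel) (\<lambda>\<xi>. \<lambda>i\<in>{..<n}. \<Sum>r\<in>K i. \<xi> r)
          = (\<Pi>\<^sub>M i\<in>{..<n}. distr (incr_law J) borel (\<lambda>\<xi>. \<Sum>r\<in>K i. \<xi> r))"
        using I_indep False
        by (subst (asm) I.indep_vars_iff_distr_eq_PiM')
          (auto simp: measurable_cong_sets[OF sets_incr_law[OF J] refl] K_def
            intro!: borel_measurable_sum measurable_component_singleton)
      also have "\<dots> = (\<Pi>\<^sub>M i\<in>{..<n}. distr L borel (?inc i))"
        by (intro PiM_cong) (auto simp: one)
      finally have joint: "distr L (\<Pi>\<^sub>M i\<in>{..<n}. borel) (\<lambda>\<omega>. \<lambda>i\<in>{..<n}. ?inc i \<omega>)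
          = (\<Pi>\<^sub>M i\<in>{..<n}. distr L borel (?inc i))" .
      show ?thesis
      proof (subst L.indep_vars_iff_distr_eq_PiM')
        show "L.random_variable borel (?inc i)" if "i \<in> {..<n}" for i
          using that by (intro borel_measurable_diff meas t_nonneg) auto
      qed (use False joint in auto)
    qed
  qed
  have "additive_process \<mu> L (\<lambda>t \<omega>. \<omega> t)"
    by (intro additive_process.intro additive_process_axioms.intro convolution_hemigroup_axioms
        prob_L meas start incr indep)
  then show ?thesis by (rule that)
qed

section \<open>Counting oscillations\<close>

text \<open>The walk moves by at most \<open>2 * e\<close> between two resets, so every oscillation larger than that forces a reset.\<close>

primrec reset_walk :: "real \<Rightarrow> (nat \<Rightarrow> 'e::real_normed_vector) \<Rightarrow> nat \<Rightarrow> nat \<times> 'e" where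
  "reset_walk e \<xi> 0 = (0, 0)"
| "reset_walk e \<xi> (Suc k) =
    (if e < norm (snd (reset_walk e \<xi> k) + \<xi> k) then (Suc (fst (reset_walk e \<xi> k)), 0)
     else (fst (reset_walk e \<xi> k), snd (reset_walk e \<xi> k) + \<xi> k))"

lemma norm_reset_walk: "0 \<le> e \<Longrightarrow> norm (snd (reset_walk e \<xi> k)) \<le> e"
  by (induction k) auto

lemma reset_walk_cong: "(\<And>i. i < k \<Longrightarrow> \<xi> i = \<xi>' i) \<Longrightarrow> reset_walk e \<xi> k = reset_walk e \<xi>' k"
  by (induction k) auto

lemma resets_mono: "j \<le> k \<Longrightarrow> fst (reset_walk e \<xi> j) \<le> fst (reset_walk e \<xi> k)"
  by (induction k rule: dec_induct) auto

lemma reset_walk_no_reset: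
  fixes x :: "nat \<Rightarrow> 'e::real_normed_vector"
  defines "\<xi> \<equiv> \<lambda>i. x (Suc i) - x i"
  assumes "j \<le> k" "fst (reset_walk e \<xi> j) = fst (reset_walk e \<xi> k)"
  shows "snd (reset_walk e \<xi> k) - snd (reset_walk e \<xi> j) = x k - x j"
  using assms(2,3)
proof (induction k rule: dec_induct)
  case (step k)
  have "fst (reset_walk e \<xi> j) \<le> fst (reset_walk e \<xi> k)" "fst (reset_walk e \<xi> k) \<le> fst (reset_walk e \<xi> (Suc k))"
    using step.hyps(1) by (intro resets_mono; simp)+
  with step.prems have eq: "fst (reset_walk e \<xi> j) = fst (reset_walk e \<xi> k)" by linarith
  with step.prems have "\<not> e < norm (snd (reset_walk e \<xi> k) + \<xi> k)" by auto
  with step.IH[OF eq] show ?case by (simp add: \<xi>_def algebra_simps)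
qed simp

text \<open>Each pair forces a reset between its own two indices, and the later pairs start no
  earlier than \<open>b\<close>. The index \<open>j\<close> is arbitrary so that the induction can
  resume at the index of \<open>b\<close>.\<close>

lemma osc_le_resets:
  fixes y :: "real \<Rightarrow> 'e::real_normed_vector"
  assumes "0 \<le> e" and t: "strict_mono_on {..n} t"
    and "osc y (2 * e) p (t ` {..n} \<inter> {t j..})" "j \<le> n"
  defines "\<xi> \<equiv> \<lambda>i. y (t (Suc i)) - y (t i)"
  shows "p + fst (reset_walk e \<xi> j) \<le> fst (reset_walk e \<xi> n)"
  using assms(3,4)
proof (induction p arbitrary: j)
  case 0
  then show ?case by (simp add: resets_mono)
next
  case (Suc p)
  then obtain a b where ab: "a \<in> t ` {..n} \<inter> {t j..}" "b \<in> t ` {..n} \<inter> {t j..}" "a < b"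
    "2 * e < dist (y a) (y b)" "osc y (2 * e) p (t ` {..n} \<inter> {t j..} \<inter> {b..})"
    unfolding osc.simps by blast
  then obtain i k where ik: "i \<le> n" "k \<le> n" "a = t i" "b = t k" by auto
  have le_iff: "t i \<le> t k \<longleftrightarrow> i \<le> k" if "i \<le> n" "k \<le> n" for i k
    using that t by (simp add: strict_mono_on_less_eq)
  have "j \<le> i" using ab(1) ik le_iff[of j i] Suc.prems(2) by auto
  have "i < k" using ab(3) ik le_iff[of k i] by auto
  have "fst (reset_walk e \<xi> i) \<noteq> fst (reset_walk e \<xi> k)"
  proof
    assume "fst (reset_walk e \<xi> i) = fst (reset_walk e \<xi> k)"
    then have "snd (reset_walk e \<xi> k) - snd (reset_walk e \<xi> i) = y b - y a"
      using reset_walk_no_reset[of i k e "\<lambda>i. y (t i)"] \<open>i < k\<close> ik by (simp add: \<xi>_def)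
    then have "dist (y a) (y b) \<le> norm (snd (reset_walk e \<xi> k)) + norm (snd (reset_walk e \<xi> i))"
      by (metis dist_commute dist_norm norm_triangle_ineq4)
    also have "\<dots> \<le> 2 * e"
      using norm_reset_walk[OF \<open>0 \<le> e\<close>, of \<xi> k] norm_reset_walk[OF \<open>0 \<le> e\<close>, of \<xi> i] by simp
    finally show False using ab(4) by simp
  qed
  then have "fst (reset_walk e \<xi> j) < fst (reset_walk e \<xi> k)"
    using resets_mono[OF \<open>j \<le> i\<close>, of e \<xi>] resets_mono[of i k e \<xi>] \<open>i < k\<close> by linarith
  moreover have "osc y (2 * e) p (t ` {..n} \<inter> {t k..})"
    using ab(5) ik by (elim osc_mono) auto
  then have "p + fst (reset_walk e \<xi> k) \<le> fst (reset_walk e \<xi> n)"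
    using Suc.IH ik by blast
  ultimately show ?case by simp
qed

lemma measurable_reset_walk:
  fixes \<xi> :: "nat \<Rightarrow> 'w \<Rightarrow> 'e::{real_normed_vector, second_countable_topology}"
  assumes "\<And>i. i < k \<Longrightarrow> \<xi> i \<in> borel_measurable N"
  shows "(\<lambda>\<omega>. fst (reset_walk e (\<lambda>i. \<xi> i \<omega>) k)) \<in> N \<rightarrow>\<^sub>M count_space UNIV \<and>
    (\<lambda>\<omega>. snd (reset_walk e (\<lambda>i. \<xi> i \<omega>) k)) \<in> borel_measurable N"
  using assms
proof (induction k)
  case (Suc k)
  then have [measurable]: "(\<lambda>\<omega>. fst (reset_walk e (\<lambda>i. \<xi> i \<omega>) k)) \<in> N \<rightarrow>\<^sub>M count_space UNIV"
    "(\<lambda>\<omega>. snd (reset_walk e (\<lambda>i. \<xi> i \<omega>) k)) \<in> borel_measurable N" "\<xi> k \<in> borel_measurable N"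
    by auto
  show ?case
    by (simp add: if_distrib[of fst] if_distrib[of snd] cong: if_cong)
qed simp

text \<open>The quarter makes \<open>overshoot\<close> at least \<open>1\<close> far from the origin and at most \<open>1/2\<close> at the origin,
  so that it compensates the doubling at a reset.\<close>

definition overshoot :: "real \<Rightarrow> 'e::{real_normed_vector, second_countable_topology} measure \<Rightarrow> 'e \<Rightarrow> ennreal" where
  "overshoot e \<nu> d = (\<integral>\<^sup>+y. indicator {z. e < norm z} (d + y) \<partial>\<nu>) + ennreal (1/4)"

section \<open>A supermartingale bound for the number of resets\<close>

context additive_process
begin

lemma overshoot_measurable:
  assumes "0 \<le> s" "s \<le> t"
  shows "overshoot e (\<mu> s t) \<in> borel_measurable borel"
proof -
  interpret \<mu>: prob_space "\<mu> s t" by (rule prob[OF assms])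
  note [measurable_cong] = sets_\<mu>[OF assms]
  show ?thesis unfolding overshoot_def by measurable
qed

text \<open>Apart from the constant, \<open>overshoot\<close> is the probability that a path now at
  \<open>d\<close> ends beyond \<open>e\<close> at the final time. Conditioning on an intermediate
  time gives the martingale property, here by \<open>conv\<close>.\<close>

lemma nn_integral_overshoot:
  assumes "0 \<le> s" "s \<le> t" "t \<le> u"
  shows "(\<integral>\<^sup>+y. overshoot e (\<mu> t u) (d + y) \<partial>\<mu> s t) = overshoot e (\<mu> s u) d"
proof -
  interpret a: prob_space "\<mu> s t" using assms by (intro prob) auto
  interpret b: prob_space "\<mu> t u" using assms by (intro prob) auto
  have [measurable_cong]: "sets (\<mu> s t) = sets borel" "sets (\<mu> t u) = sets borel"
    using assms by (auto simp: sets_\<mu>)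
  have "(\<integral>\<^sup>+y. overshoot e (\<mu> t u) (d + y) \<partial>\<mu> s t)
      = (\<integral>\<^sup>+y. \<integral>\<^sup>+z. indicator {z. e < norm z} (d + y + z) \<partial>\<mu> t u \<partial>\<mu> s t) + ennreal (1/4)"
    unfolding overshoot_def by (subst nn_integral_add) (auto simp: a.emeasure_space_1)
  also have "(\<integral>\<^sup>+y. \<integral>\<^sup>+z. indicator {z. e < norm z} (d + y + z) \<partial>\<mu> t u \<partial>\<mu> s t)
      = (\<integral>\<^sup>+p. indicator {z. e < norm z} (d + fst p + snd p) \<partial>(\<mu> s t \<Otimes>\<^sub>M \<mu> t u))"
    by (subst b.nn_integral_fst[symmetric]) auto
  also have "\<dots> = (\<integral>\<^sup>+y. indicator {z. e < norm z} (d + y) \<partial>\<mu> s u)"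
    unfolding conv[OF assms, symmetric] by (subst nn_integral_distr) (auto simp: split_beta' add.assoc)
  finally show ?thesis by (simp add: overshoot_def)
qed

text \<open>For \<open>norm d > 2 * e\<close>, either \<open>d + y\<close> or \<open>y\<close> lies
  beyond \<open>e\<close>. The second event has probability at most \<open>1/4\<close>, which is the
  constant built into \<open>overshoot\<close>; so the total is at least \<open>1\<close>. At the
  origin the total is at most \<open>1/4 + 1/4\<close>.\<close>

lemma exceed_le_quarter:
  assumes "0 \<le> s" "s \<le> t" "measure (\<mu> s t) {y. e < norm y} \<le> 1/4"
  shows "overshoot e (\<mu> s t) 0 \<le> ennreal (1/2)"
    and "2 * e < norm d \<Longrightarrow> 1 \<le> overshoot e (\<mu> s t) d"
proof -
  interpret \<mu>: prob_space "\<mu> s t" using assms by (intro prob) auto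
  note [measurable_cong] = sets_\<mu>[OF assms(1,2)]
  have [simp]: "space (\<mu> s t) = UNIV"
    using sets_eq_imp_space_eq[OF sets_\<mu>[OF assms(1,2)]] by simp
  have [measurable]: "{y. e < norm y} \<in> sets (borel :: 'e measure)" by measurable
  have em: "emeasure (\<mu> s t) {y. e < norm y} \<le> ennreal (1/4)"
    using assms(3) by (simp add: \<mu>.emeasure_eq_measure ennreal_leI)
  have "overshoot e (\<mu> s t) 0 = emeasure (\<mu> s t) {y. e < norm y} + ennreal (1/4)"
    by (simp add: overshoot_def)
  also have "\<dots> \<le> ennreal (1/4) + ennreal (1/4)" by (intro add_right_mono em)
  also have "\<dots> = ennreal (1/2)" by (subst ennreal_plus[symmetric]) auto
  finally show "overshoot e (\<mu> s t) 0 \<le> ennreal (1/2)" .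
  assume d: "2 * e < norm d"
  have "1 = (\<integral>\<^sup>+y. 1 \<partial>\<mu> s t)" using \<mu>.emeasure_space_1 by simp
  also have "\<dots> \<le> (\<integral>\<^sup>+y. indicator {z. e < norm z} (d + y) + indicator {z. e < norm z} y \<partial>\<mu> s t)"
  proof (rule nn_integral_mono)
    fix y
    have "norm d \<le> norm (d + y) + norm y"
      using norm_triangle_ineq4[of "d + y" y] by simp
    with d have "e < norm (d + y) \<or> e < norm y" by linarith
    then show "(1::ennreal) \<le> indicator {z. e < norm z} (d + y) + indicator {z. e < norm z} y"
      by (auto simp: indicator_def)
  qed
  also have "\<dots> = (\<integral>\<^sup>+y. indicator {z. e < norm z} (d + y) \<partial>\<mu> s t) + emeasure (\<mu> s t) {y. e < norm y}"
    by (subst nn_integral_add) auto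
  also have "\<dots> \<le> overshoot e (\<mu> s t) d"
    unfolding overshoot_def by (intro add_left_mono em)
  finally show "1 \<le> overshoot e (\<mu> s t) d" .
qed

text \<open>The potential \<open>2 ^ c\<close> times the overshoot of the current position has
  nonincreasing expectation. Without a reset it is preserved in mean. A reset doubles the first
  factor but lowers the second from at least \<open>1\<close> to at most \<open>1/2\<close>. It
  starts at no more than \<open>1/2\<close>, and the overshoot never drops below \<open>1/4\<close>,
  which leaves the bound \<open>2\<close>.\<close>

lemma expectation_resets:
  assumes t: "0 \<le> t 0" "\<And>i. i < n \<Longrightarrow> t i \<le> t (Suc i)"
    and small: "\<And>i. i \<le> n \<Longrightarrow> measure (\<mu> (t i) (t n)) {y. e < norm y} \<le> 1/4"
  defines "\<xi> \<equiv> \<lambda>i \<omega>. X (t (Suc i)) \<omega> - X (t i) \<omega>"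
  defines "W \<equiv> \<lambda>k \<omega>. reset_walk (2 * e) (\<lambda>i. \<xi> i \<omega>) k"
  shows "(\<integral>\<^sup>+\<omega>. 2 ^ fst (W n \<omega>) \<partial>M) \<le> 2"
proof -
  have mono: "t i \<le> t j" if "i \<le> j" "j \<le> n" for i j
    using that
  proof (induction j rule: dec_induct)
    case (step j)
    then show ?case using t(2)[of j] by simp
  qed simp
  have t_nonneg: "0 \<le> t i" if "i \<le> n" for i
    using mono[of 0 i] t(1) that by simp
  have \<xi>_meas: "\<xi> i \<in> borel_measurable M" if "i < n" for i
    unfolding \<xi>_def using that by (intro borel_measurable_diff X_measurable t_nonneg) auto
  have \<xi>_law: "distr M borel (\<xi> i) = \<mu> (t i) (t (Suc i))" if "i < n" for i
    unfolding \<xi>_def using that t by (intro X_increment t_nonneg) auto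
  have \<xi>_indep: "indep_vars (\<lambda>_. borel) \<xi> {..<n}"
    using X_indep t unfolding independent_increments_def \<xi>_def by blast
  define \<Phi> where "\<Phi> k = (\<integral>\<^sup>+\<omega>. 2 ^ fst (W k \<omega>) * overshoot e (\<mu> (t k) (t n)) (snd (W k \<omega>)) \<partial>M)" for k
  have step: "\<Phi> (Suc k) \<le> \<Phi> k" if k: "k < n" for k
  proof -
    let ?h = "overshoot e (\<mu> (t (Suc k)) (t n))" and ?N = "\<Pi>\<^sub>M i\<in>{..<k}. (borel :: 'e measure)"
    have le: "0 \<le> t k" "t k \<le> t (Suc k)" "0 \<le> t (Suc k)" "t (Suc k) \<le> t n"
      using k t mono[of "Suc k" n] by (auto intro!: t_nonneg)
    note [measurable] = \<xi>_meas[OF k] overshoot_measurable[OF le(3,4)]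
    \<comment> \<open>The walk after \<open>k\<close> steps is a function of the past
      \<open>V\<close>; \<open>U\<close> below carries the next increment. Both restrict the same
      independent family to disjoint index sets.\<close>
    define V where "V \<omega> = restrict (\<lambda>i. \<xi> i \<omega>) {..<k}" for \<omega>
    define R where "R v = reset_walk (2 * e) v k" for v :: "nat \<Rightarrow> 'e"
    have [measurable]: "V \<in> M \<rightarrow>\<^sub>M ?N"
      unfolding V_def using k by (intro measurable_restrict \<xi>_meas) auto
    have R_meas [measurable]: "(\<lambda>v. fst (R v)) \<in> ?N \<rightarrow>\<^sub>M count_space UNIV" "(\<lambda>v. snd (R v)) \<in> ?N \<rightarrow>\<^sub>M borel"
      using measurable_reset_walk[of k "\<lambda>i v. v i" ?N "2 * e"] by (auto simp: R_def measurable_component_singleton)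
    have W: "W k \<omega> = R (V \<omega>)" for \<omega>
      unfolding W_def R_def V_def by (intro reset_walk_cong) auto
    \<comment> \<open>The potential after the next step if a possible reset is ignored; it dominates
      the true one and integrates exactly.\<close>
    define \<phi> where "\<phi> v y = 2 ^ fst (R v) * ?h (snd (R v) + y)" for v y
    have \<phi>_meas [measurable]: "(\<lambda>p. \<phi> (fst p) (snd p)) \<in> borel_measurable (?N \<Otimes>\<^sub>M borel)"
      unfolding \<phi>_def by measurable
    let ?N' = "\<Pi>\<^sub>M i\<in>{k}. (borel :: 'e measure)"
    define U where "U \<omega> = restrict (\<lambda>i. \<xi> i \<omega>) {k}" for \<omega>
    have U_meas [measurable]: "U \<in> M \<rightarrow>\<^sub>M ?N'"
      unfolding U_def using k by (intro measurable_restrict \<xi>_meas) auto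
    have indep: "indep_var ?N V ?N' U"
      using k unfolding V_def[abs_def] U_def[abs_def] by (intro indep_var_restrict[OF \<xi>_indep]) auto
    have k_meas [measurable]: "(\<lambda>u. u k) \<in> ?N' \<rightarrow>\<^sub>M borel"
      by (intro measurable_component_singleton) simp
    have [measurable]: "(\<lambda>p. snd p k) \<in> ?N \<Otimes>\<^sub>M ?N' \<rightarrow>\<^sub>M borel"
      by (rule measurable_compose[OF measurable_snd k_meas])
    have \<phi>'_meas [measurable]: "(\<lambda>p. \<phi> (fst p) (snd p k)) \<in> borel_measurable (?N \<Otimes>\<^sub>M ?N')"
      unfolding \<phi>_def by measurable
    have VU_meas: "(\<lambda>\<omega>. (V \<omega>, U \<omega>)) \<in> M \<rightarrow>\<^sub>M ?N \<Otimes>\<^sub>M ?N'"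
      by measurable
    interpret D: prob_space "distr M ?N' U" by (rule prob_space_distr[OF U_meas])
    have "\<Phi> (Suc k) \<le> (\<integral>\<^sup>+\<omega>. \<phi> (V \<omega>) (\<xi> k \<omega>) \<partial>M)"
      unfolding \<Phi>_def
    proof (rule nn_integral_mono)
      fix \<omega>
      let ?c = "fst (W k \<omega>)" and ?d = "snd (W k \<omega>)"
      show "2 ^ fst (W (Suc k) \<omega>) * ?h (snd (W (Suc k) \<omega>)) \<le> \<phi> (V \<omega>) (\<xi> k \<omega>)"
      proof (cases "2 * e < norm (?d + \<xi> k \<omega>)")
        case True
        have "measure (\<mu> (t (Suc k)) (t n)) {y. e < norm y} \<le> 1/4"
          using k by (intro small) auto
        note q = exceed_le_quarter[OF le(3,4) this]
        have "2 ^ fst (W (Suc k) \<omega>) * ?h (snd (W (Suc k) \<omega>)) = 2 ^ ?c * (2 * ?h 0)"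
          using True by (simp add: W_def ac_simps)
        also have "2 * ?h 0 \<le> 2 * ennreal (1/2)" by (intro mult_left_mono q) auto
        also have "2 * ennreal (1/2) = 1"
          using ennreal_mult[of 2 "1/2"] by simp
        also have "1 \<le> ?h (?d + \<xi> k \<omega>)" by (rule q(2)[OF True])
        finally show ?thesis by (simp add: \<phi>_def W mult_left_mono)
      next
        case False
        then show ?thesis by (simp add: \<phi>_def W[symmetric]) (simp add: W_def)
      qed
    qed
    also have "\<dots> = (\<integral>\<^sup>+p. \<phi> (fst p) (snd p k) \<partial>distr M (?N \<Otimes>\<^sub>M ?N') (\<lambda>\<omega>. (V \<omega>, U \<omega>)))"
      using \<phi>'_meas by (subst nn_integral_distr[OF VU_meas]) (simp_all add: U_def)
    also have "\<dots> = (\<integral>\<^sup>+p. \<phi> (fst p) (snd p k) \<partial>(distr M ?N V \<Otimes>\<^sub>M distr M ?N' U))"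
      using indep by (simp add: indep_var_distribution_eq)
    also have "\<dots> = (\<integral>\<^sup>+v. \<integral>\<^sup>+u. \<phi> v (u k) \<partial>distr M ?N' U \<partial>distr M ?N V)"
      by (subst D.nn_integral_fst[symmetric]) auto
    also have "\<dots> = (\<integral>\<^sup>+\<omega>. \<integral>\<^sup>+u. \<phi> (V \<omega>) (u k) \<partial>distr M ?N' U \<partial>M)"
      by (subst nn_integral_distr) auto
    also have "\<dots> = (\<integral>\<^sup>+\<omega>. \<integral>\<^sup>+y. \<phi> (V \<omega>) y \<partial>distr M borel (\<xi> k) \<partial>M)"
    proof (rule nn_integral_cong)
      fix \<omega> assume "\<omega> \<in> space M"
      then have V: "V \<omega> \<in> space ?N" by (rule measurable_space[rotated]) measurable
      have [measurable]: "(\<lambda>y. \<phi> (V \<omega>) y) \<in> borel_measurable borel"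
        unfolding \<phi>_def by measurable
      show "(\<integral>\<^sup>+u. \<phi> (V \<omega>) (u k) \<partial>distr M ?N' U) = (\<integral>\<^sup>+y. \<phi> (V \<omega>) y \<partial>distr M borel (\<xi> k))"
        by (simp add: nn_integral_distr U_def[of _] cong: nn_integral_cong)
    qed
    also have "\<dots> = \<Phi> k"
      unfolding \<Phi>_def
    proof (rule nn_integral_cong)
      fix \<omega>
      have "(\<integral>\<^sup>+y. \<phi> (V \<omega>) y \<partial>distr M borel (\<xi> k)) = 2 ^ fst (W k \<omega>) * (\<integral>\<^sup>+y. ?h (snd (W k \<omega>) + y) \<partial>distr M borel (\<xi> k))"
        unfolding \<phi>_def W by (rule nn_integral_cmult) simp
      also have "(\<integral>\<^sup>+y. ?h (snd (W k \<omega>) + y) \<partial>distr M borel (\<xi> k)) = overshoot e (\<mu> (t k) (t n)) (snd (W k \<omega>))"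
        unfolding \<xi>_law[OF k] by (rule nn_integral_overshoot[OF le(1,2,4)])
      finally show "(\<integral>\<^sup>+y. \<phi> (V \<omega>) y \<partial>distr M borel (\<xi> k)) = 2 ^ fst (W k \<omega>) * overshoot e (\<mu> (t k) (t n)) (snd (W k \<omega>))" .
    qed
    finally show ?thesis .
  qed
  have W_meas: "(\<lambda>\<omega>. fst (W n \<omega>)) \<in> M \<rightarrow>\<^sub>M count_space UNIV"
    unfolding W_def using measurable_reset_walk[of n \<xi> M "2 * e"] \<xi>_meas by blast
  have "\<Phi> k \<le> \<Phi> 0" if "k \<le> n" for k
    using that by (induction k) (auto intro: order_trans[OF step])
  then have "\<Phi> n \<le> \<Phi> 0" by simp
  also have "\<Phi> 0 \<le> ennreal (1/2)"
    using exceed_le_quarter(1)[of "t 0" "t n" e] t(1) mono[of 0 n] small[of 0] by (simp add: \<Phi>_def W_def emeasure_space_1)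
  finally have \<Phi>_n: "\<Phi> n \<le> ennreal (1/2)" .
  have "(\<integral>\<^sup>+\<omega>. 2 ^ fst (W n \<omega>) \<partial>M) * ennreal (1/4) = (\<integral>\<^sup>+\<omega>. 2 ^ fst (W n \<omega>) * ennreal (1/4) \<partial>M)"
    using W_meas by (subst nn_integral_multc) auto
  \<comment> \<open>The summand \<open>1/4\<close> of \<open>overshoot\<close> is a lower bound
    wherever the walk ends.\<close>
  also have "\<dots> \<le> \<Phi> n"
    unfolding \<Phi>_def by (intro nn_integral_mono mult_left_mono) (auto simp: overshoot_def)
  finally have "(\<integral>\<^sup>+\<omega>. 2 ^ fst (W n \<omega>) \<partial>M) * ennreal (1/4) \<le> ennreal (1/2)"
    using \<Phi>_n by (rule order_trans)
  then have "((\<integral>\<^sup>+\<omega>. 2 ^ fst (W n \<omega>) \<partial>M) * ennreal (1/4)) * 4 \<le> ennreal (1/2) * 4"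
    by (rule mult_right_mono) simp
  moreover have "ennreal (1/4) * 4 = 1" "ennreal (1/2) * 4 = 2"
    using ennreal_mult[of "1/4" 4] ennreal_mult[of "1/2" 4] by simp_all
  ultimately show ?thesis by (simp add: mult.assoc)
qed

end

section \<open>The modification with regular paths\<close>

lemma finite_set_strict_mono_enum:
  fixes F :: "'a::linorder set"
  assumes "finite F" "F \<noteq> {}"
  obtains n t where "strict_mono_on {..n} t" "F = t ` {..n::nat}"
proof -
  define l where "l = sorted_list_of_set F"
  have l: "set l = F" "l \<noteq> []" "sorted_wrt (<) l"
    using assms by (auto simp: l_def)
  have "strict_mono_on {..length l - 1} ((!) l)"
    using l(2,3) by (auto simp: strict_mono_on_def Suc_diff_Suc intro!: sorted_wrt_nth_less[of "(<)"])
  moreover have "{..length l - 1} = {..<length l}"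
    using l(2) by (cases l) auto
  then have "F = (!) l ` {..length l - 1}"
    using l(1) by (auto simp: set_conv_nth)
  ultimately show ?thesis by (rule that)
qed

text \<open>Independence is a property of the joint law, which almost sure changes leave
  untouched.\<close>

lemma (in prob_space) indep_vars_cong_AE:
  assumes X: "indep_vars N X I" and "countable I"
    and Y: "\<And>i. i \<in> I \<Longrightarrow> Y i \<in> M \<rightarrow>\<^sub>M N i"
    and eq: "\<And>i. i \<in> I \<Longrightarrow> AE \<omega> in M. X i \<omega> = Y i \<omega>"
  shows "indep_vars N Y I"
proof (cases "I = {}")
  case True
  then show ?thesis unfolding indep_vars_def indep_sets_def by simp
next
  case False
  have rv: "X i \<in> M \<rightarrow>\<^sub>M N i" if "i \<in> I" for i
    using X that by (auto simp: indep_vars_def)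
  have "AE \<omega> in M. \<forall>i\<in>I. X i \<omega> = Y i \<omega>"
    using eq \<open>countable I\<close> by (simp add: AE_ball_countable)
  then have "AE \<omega> in M. (\<lambda>i\<in>I. Y i \<omega>) = (\<lambda>i\<in>I. X i \<omega>)"
    by eventually_elim auto
  then have "distr M (\<Pi>\<^sub>M i\<in>I. N i) (\<lambda>\<omega>. \<lambda>i\<in>I. Y i \<omega>) = distr M (\<Pi>\<^sub>M i\<in>I. N i) (\<lambda>\<omega>. \<lambda>i\<in>I. X i \<omega>)"
    by (intro distr_cong_AE) (auto intro!: measurable_restrict rv Y)
  also have "\<dots> = (\<Pi>\<^sub>M i\<in>I. distr M (N i) (X i))"
    using X False rv by (simp add: indep_vars_iff_distr_eq_PiM')
  also have "\<dots> = (\<Pi>\<^sub>M i\<in>I. distr M (N i) (Y i))"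
    using eq by (intro PiM_cong distr_cong_AE) (auto intro: rv Y)
  finally have joint: "distr M (\<Pi>\<^sub>M i\<in>I. N i) (\<lambda>\<omega>. \<lambda>i\<in>I. Y i \<omega>) = (\<Pi>\<^sub>M i\<in>I. distr M (N i) (Y i))" .
  show ?thesis
    by (subst indep_vars_iff_distr_eq_PiM'[OF False Y]) (simp_all only: joint)
qed

context additive_process
begin

lemma osc_sets:
  assumes "countable A" "A \<subseteq> {0..}"
  shows "{\<omega>\<in>space M. osc (\<lambda>t. X t \<omega>) e p A} \<in> events"
  using assms
proof (induction p arbitrary: A)
  case (Suc p)
  have "{\<omega>\<in>space M. osc (\<lambda>t. X t \<omega>) e (Suc p) A} =
    (\<Union>a\<in>A. \<Union>b\<in>A \<inter> {a<..}. {\<omega>\<in>space M. e < dist (X a \<omega>) (X b \<omega>)} \<inter> {\<omega>\<in>space M. osc (\<lambda>t. X t \<omega>) e p (A \<inter> {b..})})"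
    by auto
  also have "\<dots> \<in> events"
  proof (intro sets.countable_UN'' sets.Int)
    fix a b assume ab: "a \<in> A" "b \<in> A \<inter> {a<..}"
    have [measurable]: "X a \<in> borel_measurable M" "X b \<in> borel_measurable M"
      using ab Suc.prems by (auto intro!: X_measurable)
    show "{\<omega>\<in>space M. e < dist (X a \<omega>) (X b \<omega>)} \<in> events" by measurable
    show "{\<omega>\<in>space M. osc (\<lambda>t. X t \<omega>) e p (A \<inter> {b..})} \<in> events"
      using Suc.prems by (intro Suc.IH) auto
  qed (use Suc.prems in auto)
  finally show ?case .
qed simp

text \<open>This is Markov's inequality for \<open>2 ^ c\<close>. The walk restarts at
  \<open>2 * e\<close>, and \<open>osc_le_resets\<close> doubles that threshold, hence
  \<open>4 * e\<close>. The bound does not depend on \<open>F\<close>.\<close>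

lemma prob_osc_finite:
  assumes F: "finite F" "F \<subseteq> {a..b}" and "0 \<le> a" "0 < e"
    and small: "\<And>s t. a \<le> s \<Longrightarrow> s \<le> t \<Longrightarrow> t \<le> b \<Longrightarrow> measure (\<mu> s t) {y. e < norm y} \<le> 1/4"
  shows "2 ^ p * emeasure M {\<omega>\<in>space M. osc (\<lambda>t. X t \<omega>) (4 * e) p F} \<le> 2"
proof (cases "F = {}")
  case True
  then show ?thesis by (cases p) (auto simp: emeasure_space_1)
next
  case False
  obtain n and t where t: "strict_mono_on {..n} t" "F = t ` {..n::nat}"
    by (rule finite_set_strict_mono_enum[OF F(1) False])
  have t_le: "t i \<le> t j" if "i \<le> j" "j \<le> n" for i j
    using t(1) that by (simp add: strict_mono_on_less_eq)
  have ab: "a \<le> t i" "t i \<le> b" if "i \<le> n" for i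
    using F(2) t(2) that by auto
  let ?W = "\<lambda>\<omega>. reset_walk (2 * e) (\<lambda>i. X (t (Suc i)) \<omega> - X (t i) \<omega>) n"
  have ev: "{\<omega>\<in>space M. osc (\<lambda>t. X t \<omega>) (4 * e) p F} \<in> events"
    using F \<open>0 \<le> a\<close> by (intro osc_sets) (auto intro: countable_finite)
  have "2 ^ p * emeasure M {\<omega>\<in>space M. osc (\<lambda>t. X t \<omega>) (4 * e) p F}
      = (\<integral>\<^sup>+\<omega>. 2 ^ p * indicator {\<omega>\<in>space M. osc (\<lambda>t. X t \<omega>) (4 * e) p F} \<omega> \<partial>M)"
    using ev by (simp add: nn_integral_cmult)
  also have "\<dots> \<le> (\<integral>\<^sup>+\<omega>. 2 ^ fst (?W \<omega>) \<partial>M)"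
  proof (rule nn_integral_mono)
    fix \<omega>
    have "p \<le> fst (?W \<omega>)" if "osc (\<lambda>t. X t \<omega>) (4 * e) p F"
    proof -
      have "F \<inter> {t 0..} = F" using t(2) t_le[of 0] by auto
      then have "osc (\<lambda>t. X t \<omega>) (2 * (2 * e)) p (t ` {..n} \<inter> {t 0..})"
        using that t(2) by simp
      from osc_le_resets[OF _ t(1) this] \<open>0 < e\<close> show ?thesis by simp
    qed
    then show "2 ^ p * indicator {\<omega>\<in>space M. osc (\<lambda>t. X t \<omega>) (4 * e) p F} \<omega> \<le> (2 ^ fst (?W \<omega>) :: ennreal)"
      by (auto simp: indicator_def intro: power_increasing)
  qed
  also have "\<dots> \<le> 2"
    using ab \<open>0 \<le> a\<close> by (intro expectation_resets small) (auto intro: t_le order_trans)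
  finally show ?thesis .
qed

text \<open>The bound for finite sets is uniform, so continuity from below carries it to the
  countable set. Having at least \<open>p\<close> oscillations for every \<open>p\<close> then has
  probability at most \<open>2 / 2 ^ p\<close> for each \<open>p\<close>.\<close>

lemma AE_finite_osc:
  assumes D: "countable D" and "0 \<le> a" "0 < e"
    and small: "\<And>s t. a \<le> s \<Longrightarrow> s \<le> t \<Longrightarrow> t \<le> b \<Longrightarrow> measure (\<mu> s t) {y. e < norm y} \<le> 1/4"
  shows "AE \<omega> in M. \<exists>p. \<not> osc (\<lambda>t. X t \<omega>) (4 * e) p (D \<inter> {a..b})"
proof -
  define A where "A = D \<inter> {a..b}"
  have A: "countable A" "A \<subseteq> {0..}" using D \<open>0 \<le> a\<close> by (auto simp: A_def)
  define F where "F m = to_nat_on A -` {..m} \<inter> A" for m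
  have F_fin: "finite (F m)" for m
    unfolding F_def using A(1) by (intro finite_vimage_IntI inj_on_to_nat_on) auto
  have F_mono: "F m \<subseteq> F m'" if "m \<le> m'" for m m'
    using that by (auto simp: F_def)
  define S where "S p B = {\<omega>\<in>space M. osc (\<lambda>t. X t \<omega>) (4 * e) p B}" for p B
  have S_mono: "B \<subseteq> B' \<Longrightarrow> S p B \<subseteq> S p B'" for p B B'
    unfolding S_def using osc_mono by blast
  have S_sets: "S p B \<in> events" if "B \<subseteq> A" for p B
    unfolding S_def using A(2) that by (intro osc_sets countable_subset[OF that A(1)]) auto
  have S_A: "S p A = (\<Union>m. S p (F m))" for p
  proof (intro equalityI subsetI)
    fix \<omega> assume "\<omega> \<in> S p A"
    then obtain B where B: "B \<subseteq> A" "finite B" "\<omega> \<in> S p B"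
      using osc_finite[of "\<lambda>t. X t \<omega>" "4 * e" p A] unfolding S_def by auto
    \<comment> \<open>The largest code of a point of \<open>B\<close> tells when the exhaustion
      \<open>F\<close> has absorbed all of \<open>B\<close>.\<close>
    have "B \<subseteq> F (Max (insert 0 (to_nat_on A ` B)))"
      using B by (auto simp: F_def intro!: Max_ge)
    with S_mono B(3) show "\<omega> \<in> (\<Union>m. S p (F m))" by blast
  next
    have "F m \<subseteq> A" for m by (auto simp: F_def)
    then show "\<omega> \<in> S p A" if "\<omega> \<in> (\<Union>m. S p (F m))" for \<omega>
      using that S_mono by blast
  qed
  have bound: "2 ^ p * emeasure M (S p A) \<le> 2" for p
  proof -
    have "2 ^ p * emeasure M (S p A) = (SUP m. 2 ^ p * emeasure M (S p (F m)))"
    proof -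
      have "range (\<lambda>m. S p (F m)) \<subseteq> events" using S_sets by (auto simp: F_def)
      moreover have "incseq (\<lambda>m. S p (F m))" using S_mono F_mono by (auto simp: incseq_def)
      ultimately show ?thesis
        unfolding S_A by (subst SUP_emeasure_incseq[symmetric]) (auto simp: SUP_mult_left_ennreal)
    qed
    also have "\<dots> \<le> 2"
      unfolding S_def
      by (intro SUP_least prob_osc_finite[where a = a and b = b] F_fin assms) (auto simp: F_def A_def)
    finally show ?thesis .
  qed
  define N where "N = (\<Inter>p. S p A)"
  have N: "N \<in> events" unfolding N_def using S_sets by auto
  have "prob N \<le> 2 * (1/2) ^ p" for p
  proof -
    have "ennreal (2 ^ p * prob N) \<le> 2 ^ p * emeasure M (S p A)"
      using N S_sets[of A p] by (auto simp: emeasure_eq_measure ennreal_mult ennreal_power[symmetric] N_def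
          intro!: mult_left_mono ennreal_leI finite_measure_mono)
    also have "\<dots> \<le> ennreal 2" using bound by simp
    finally have "2 ^ p * prob N \<le> 2" by (subst (asm) ennreal_le_iff) auto
    then show ?thesis by (simp add: field_simps power_one_over)
  qed
  moreover have "(\<lambda>p. 2 * (1/2) ^ p) \<longlonglongrightarrow> (2 * 0 :: real)"
    by (intro tendsto_intros LIMSEQ_realpow_zero) auto
  ultimately have "prob N \<le> 0"
    by (intro tendsto_lowerbound[of "\<lambda>p. 2 * (1/2) ^ p" "0::real" sequentially]) auto
  then have "N \<in> null_sets M"
    using N by (auto simp: null_sets_def emeasure_eq_measure measure_le_0_iff)
  then show ?thesis
    by (rule AE_I') (auto simp: N_def S_def A_def)
qed

text \<open>Stochastic continuity makes \<open>X (s n)\<close> converge to \<open>X t\<close> in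
  probability, and a limit in probability is almost surely unique. Truncating the norm at
  \<open>1\<close> expresses this through expectations, to which dominated convergence applies
  without moment assumptions.\<close>

lemma AE_limit_eq:
  assumes t: "0 \<le> t" and s: "\<And>n. t \<le> s n" "s \<longlonglongrightarrow> t"
    and lim: "AE \<omega> in M. (\<lambda>n. X (s n) \<omega>) \<longlonglongrightarrow> Y \<omega>"
    and Y [measurable]: "Y \<in> borel_measurable M"
  shows "AE \<omega> in M. Y \<omega> = X t \<omega>"
proof -
  have s_nonneg: "0 \<le> s n" for n using t s(1)[of n] by linarith
  have [measurable]: "X t \<in> borel_measurable M" "X (s n) \<in> borel_measurable M" for n
    using t s_nonneg by (auto intro!: X_measurable)
  define g where "g y = min 1 (norm y)" for y :: 'e
  have g_cont: "continuous_on UNIV g"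
    unfolding g_def by (intro continuous_intros)
  then have [measurable]: "g \<in> borel_measurable borel"
    by (rule borel_measurable_continuous_onI)
  have g_bd: "norm (g y) \<le> 1" "0 \<le> g y" for y by (auto simp: g_def)
  have conv: "(\<lambda>n. expectation (\<lambda>\<omega>. g (X (s n) \<omega> - X t \<omega>))) \<longlonglongrightarrow> expectation (\<lambda>\<omega>. g (Y \<omega> - X t \<omega>))"
  proof (rule integral_dominated_convergence[where w = "\<lambda>_. 1"])
    show "AE \<omega> in M. (\<lambda>n. g (X (s n) \<omega> - X t \<omega>)) \<longlonglongrightarrow> g (Y \<omega> - X t \<omega>)"
      using lim
    proof eventually_elim
      fix \<omega> assume "(\<lambda>n. X (s n) \<omega>) \<longlonglongrightarrow> Y \<omega>"
      then show "(\<lambda>n. g (X (s n) \<omega> - X t \<omega>)) \<longlonglongrightarrow> g (Y \<omega> - X t \<omega>)"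
        by (intro continuous_on_tendsto_compose[OF g_cont] tendsto_intros) auto
    qed
  qed (use g_bd in auto)
  \<comment> \<open>The truncated norm is at most \<epsilon> off the event that the increment
    exceeds \<epsilon>, and at most \<open>1\<close> on that event, whose probability is again at
    most \<epsilon>.\<close>
  have le: "expectation (\<lambda>\<omega>. g (Y \<omega> - X t \<omega>)) \<le> 2 * \<epsilon>" if \<epsilon>: "\<epsilon> > 0" for \<epsilon>
  proof -
    obtain \<delta> where \<delta>: "\<delta> > 0"
      "\<And>r u. 0 \<le> r \<Longrightarrow> r \<le> u \<Longrightarrow> u \<le> t + 1 \<Longrightarrow> u - r < \<delta> \<Longrightarrow> measure (\<mu> r u) {y. \<epsilon> < norm y} \<le> \<epsilon>"
      using stoch_cont[OF \<epsilon> \<epsilon>, of "t + 1"] by blast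
    have "eventually (\<lambda>n. s n < t + min \<delta> 1) sequentially"
      using s(2) \<delta>(1) by (intro order_tendstoD) auto
    then have "eventually (\<lambda>n. expectation (\<lambda>\<omega>. g (X (s n) \<omega> - X t \<omega>)) \<le> 2 * \<epsilon>) sequentially"
    proof eventually_elim
      fix n assume n: "s n < t + min \<delta> 1"
      interpret m: prob_space "\<mu> t (s n)" using t s(1) by (intro prob)
      have sets: "sets (\<mu> t (s n)) = sets borel" using t s(1) by (intro sets_\<mu>)
      note [measurable_cong] = sets
      have [simp]: "space (\<mu> t (s n)) = UNIV" using sets_eq_imp_space_eq[OF sets] by simp
      have A [measurable]: "{y. \<epsilon> < norm y} \<in> sets (borel :: 'e measure)" by measurable
      have "expectation (\<lambda>\<omega>. g (X (s n) \<omega> - X t \<omega>)) = (\<integral>y. g y \<partial>\<mu> t (s n))"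
        unfolding X_increment[OF t s(1), symmetric] by (subst integral_distr) auto
      also have "\<dots> \<le> (\<integral>y. \<epsilon> + indicator {y. \<epsilon> < norm y} y \<partial>\<mu> t (s n))"
      proof (rule integral_mono)
        show "integrable (\<mu> t (s n)) g"
          using g_bd by (intro m.integrable_const_bound[of _ 1]) auto
        show "integrable (\<mu> t (s n)) (\<lambda>y. \<epsilon> + indicator {y. \<epsilon> < norm y} y)"
          by (intro Bochner_Integration.integrable_add m.integrable_const m.integrable_const_bound[of "indicator _" 1]) auto
        show "g y \<le> \<epsilon> + indicator {y. \<epsilon> < norm y} y" for y
          using \<epsilon> by (auto simp: g_def indicator_def)
      qed
      also have "\<dots> = \<epsilon> + measure (\<mu> t (s n)) {y. \<epsilon> < norm y}"
        by (subst Bochner_Integration.integral_add[OF m.integrable_const m.integrable_const_bound[of _ 1]])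
          (auto simp: sets m.prob_space[simplified])
      also have "\<dots> \<le> 2 * \<epsilon>"
        using \<delta>(2)[of t "s n"] t s(1)[of n] n by simp
      finally show "expectation (\<lambda>\<omega>. g (X (s n) \<omega> - X t \<omega>)) \<le> 2 * \<epsilon>" .
    qed
    with conv show ?thesis by (intro tendsto_upperbound) auto
  qed
  have "expectation (\<lambda>\<omega>. g (Y \<omega> - X t \<omega>)) \<le> 0"
  proof (rule field_le_epsilon)
    fix \<epsilon> :: real assume "0 < \<epsilon>"
    then show "expectation (\<lambda>\<omega>. g (Y \<omega> - X t \<omega>)) \<le> 0 + \<epsilon>" using le[of "\<epsilon> / 2"] by simp
  qed
  moreover have "integrable M (\<lambda>\<omega>. g (Y \<omega> - X t \<omega>))"
    using g_bd by (intro integrable_const_bound[of _ 1]) auto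
  ultimately have "AE \<omega> in M. g (Y \<omega> - X t \<omega>) = 0"
    using g_bd(2) by (subst integral_nonneg_eq_0_iff_AE[symmetric]) (auto intro: antisym integral_nonneg)
  then show ?thesis
    by eventually_elim (auto simp: g_def min_def split: if_splits)
qed

text \<open>Rational endpoints leave only countably many intervals to examine, so their exceptional
  null sets can be united. At \<open>t = 0\<close> the left endpoint has to be \<open>0\<close>
  itself.\<close>

lemma rational_neighbourhood:
  assumes "0 \<le> t" "0 < e"
  obtains q r where "q \<in> \<rat>" "r \<in> \<rat>" "0 \<le> q" "q \<le> t" "t < r" "0 < t \<Longrightarrow> q < t"
    "\<And>s u. q \<le> s \<Longrightarrow> s \<le> u \<Longrightarrow> u \<le> r \<Longrightarrow> measure (\<mu> s u) {y. e < norm y} \<le> 1/4"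
proof -
  obtain \<delta> where \<delta>: "\<delta> > 0"
    "\<And>s u. 0 \<le> s \<Longrightarrow> s \<le> u \<Longrightarrow> u \<le> t + 1 \<Longrightarrow> u - s < \<delta> \<Longrightarrow> measure (\<mu> s u) {y. e < norm y} \<le> 1/4"
    using stoch_cont[OF \<open>0 < e\<close>, of "1/4" "t + 1"] by auto
  \<comment> \<open>Using \<open>\<delta>/2\<close> on either side keeps \<open>r - q\<close> below
    \<delta>; the \<open>1\<close> keeps \<open>r\<close> within the horizon
    \<open>t + 1\<close>.\<close>
  obtain r where r: "r \<in> \<rat>" "t < r" "r < t + min (\<delta>/2) 1"
    using Rats_dense_in_real[of t "t + min (\<delta>/2) 1"] \<delta>(1) by auto
  have "\<exists>q\<in>\<rat>. 0 \<le> q \<and> q \<le> t \<and> t - \<delta>/2 < q \<and> (0 < t \<longrightarrow> q < t)"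
  proof (cases "t = 0")
    case True
    then show ?thesis using \<delta>(1) by (intro bexI[of _ 0]) auto
  next
    case False
    then obtain q where "q \<in> \<rat>" "max 0 (t - \<delta>/2) < q" "q < t"
      using Rats_dense_in_real[of "max 0 (t - \<delta>/2)" t] \<open>0 \<le> t\<close> \<delta>(1) by auto
    then show ?thesis by (intro bexI[of _ q]) auto
  qed
  then obtain q where q: "q \<in> \<rat>" "0 \<le> q" "q \<le> t" "t - \<delta>/2 < q" "0 < t \<longrightarrow> q < t" by blast
  show ?thesis
    by (rule that[of q r]) (use q r \<delta>(2) in auto)
qed

text \<open>Finite oscillation near every time holds simultaneously off one null set, so right
  limits along the rationals exist at all times there. Stochastic continuity identifies them with
  \<open>X t\<close>, with an exceptional set that may depend on \<open>t\<close>.\<close>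

theorem cadlag_modification:
  obtains Z where "\<And>t. 0 \<le> t \<Longrightarrow> Z t \<in> borel_measurable M"
    "\<And>\<omega>. \<omega> \<in> space M \<Longrightarrow> cadlag (\<lambda>t. Z t \<omega>)"
    "\<And>t. 0 \<le> t \<Longrightarrow> AE \<omega> in M. Z t \<omega> = X t \<omega>"
proof -
  define D :: "real set" where "D = \<rat> \<inter> {0..}"
  have D: "countable D" by (auto simp: D_def countable_rat)
  have D_dense: "\<exists>d\<in>D. a < d \<and> d < b" if "0 \<le> a" "a < b" for a b
    using Rats_dense_in_real[OF that(2)] that(1) by (auto simp: D_def)
  define small where "small q r m \<longleftrightarrow>
    (\<forall>s u. q \<le> s \<longrightarrow> s \<le> u \<longrightarrow> u \<le> r \<longrightarrow> measure (\<mu> s u) {y. 1 / real (Suc m) < norm y} \<le> 1/4)" for q r m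
  \<comment> \<open>All quantifiers outside the inner \<open>\<exists>p\<close> range over countable
    sets, so the almost sure statements for single \<open>m\<close>, \<open>q\<close>,
    \<open>r\<close> combine.\<close>
  define good where "good \<omega> \<longleftrightarrow> (\<forall>m. \<forall>q\<in>D. \<forall>r\<in>D. small q r m \<longrightarrow>
    (\<exists>p. \<not> osc (\<lambda>t. X t \<omega>) (4 * (1 / real (Suc m))) p (D \<inter> {q..r})))" for \<omega>
  have "AE \<omega> in M. good \<omega>"
  proof -
    have "AE \<omega> in M. small q r m \<longrightarrow> (\<exists>p. \<not> osc (\<lambda>t. X t \<omega>) (4 * (1 / real (Suc m))) p (D \<inter> {q..r}))"
      if "q \<in> D" "r \<in> D" for m q r
    proof (cases "small q r m")
      case True
      then have "AE \<omega> in M. \<exists>p. \<not> osc (\<lambda>t. X t \<omega>) (4 * (1 / real (Suc m))) p (D \<inter> {q..r})"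
        using that by (intro AE_finite_osc[OF D]) (auto simp: small_def D_def)
      then show ?thesis by eventually_elim blast
    qed simp
    then show ?thesis
      unfolding good_def by (simp add: AE_all_countable AE_ball_countable[OF D])
  qed
  then obtain N where N: "{\<omega>\<in>space M. \<not> good \<omega>} \<subseteq> N" "emeasure M N = 0" "N \<in> events"
    by (rule AE_E)
  \<comment> \<open>The measurable null set \<open>N\<close> contains all bad paths; its complement
    gives a measurable domain on which to define \<open>Z\<close>.\<close>
  define G where "G = space M - N"
  have G [measurable]: "G \<in> events" using N by (auto simp: G_def)
  have AE_G: "AE \<omega> in M. \<omega> \<in> G"
    using N by (intro AE_I'[of N]) (auto simp: G_def null_sets_def)
  \<comment> \<open>The default \<open>0\<close> off \<open>G\<close> makes every path cadlag, not
    merely almost every one.\<close>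
  define Z where "Z t \<omega> = (if \<omega> \<in> G then Lim (at t within (D \<inter> {t<..})) (\<lambda>s. X s \<omega>) else 0)" for t \<omega>
  have osc_bounded: "\<exists>q r p. 0 \<le> q \<and> q \<le> t \<and> t < r \<and> (0 < t \<longrightarrow> q < t) \<and> \<not> osc (\<lambda>t. X t \<omega>) e p (D \<inter> {q..r})"
    if "\<omega> \<in> G" "0 \<le> t" "0 < e" for \<omega> t e
  proof -
    obtain m where m: "4 * (1 / real (Suc m)) \<le> e"
      using reals_Archimedean[of "e/4"] \<open>0 < e\<close> by (auto simp: field_simps intro: less_imp_le)
    obtain q r where qr: "q \<in> \<rat>" "r \<in> \<rat>" "0 \<le> q" "q \<le> t" "t < r" "0 < t \<Longrightarrow> q < t"
      "\<And>s u. q \<le> s \<Longrightarrow> s \<le> u \<Longrightarrow> u \<le> r \<Longrightarrow> measure (\<mu> s u) {y. 1 / real (Suc m) < norm y} \<le> 1/4"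
      by (rule rational_neighbourhood[OF \<open>0 \<le> t\<close>, of "1 / real (Suc m)"]) auto
    have "good \<omega>" using N(1) that(1) by (auto simp: G_def)
    moreover have "q \<in> D" "r \<in> D" "small q r m" using qr by (auto simp: D_def small_def)
    ultimately obtain p where "\<not> osc (\<lambda>t. X t \<omega>) (4 * (1 / real (Suc m))) p (D \<inter> {q..r})"
      unfolding good_def by blast
    then have "\<not> osc (\<lambda>t. X t \<omega>) e p (D \<inter> {q..r})"
      using osc_antimono m by blast
    with qr show ?thesis by blast
  qed
  have nontriv: "at t within (D \<inter> {t<..}) \<noteq> bot" if "0 \<le> t" for t
  proof -
    have "\<exists>s\<in>D \<inter> {t<..}. s \<noteq> t \<and> dist s t < e" if "e > 0" for e
      using D_dense[OF \<open>0 \<le> t\<close>, of "t + e"] that by (force simp: dist_real_def)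
    then show ?thesis
      by (metis islimpt_approachable trivial_limit_within)
  qed
  have Z_path: "cadlag (\<lambda>t. Z t \<omega>) \<and> (\<forall>t\<ge>0. ((\<lambda>s. X s \<omega>) \<longlongrightarrow> Z t \<omega>) (at t within (D \<inter> {t<..})))"
    if \<omega>: "\<omega> \<in> G" for \<omega>
  proof -
    have right: "\<exists>p. \<exists>d>t. \<not> osc (\<lambda>t. X t \<omega>) e p (D \<inter> {t<..<d})" if te: "0 < e" "0 \<le> t" for e t
    proof -
      obtain q r p where *: "0 \<le> q" "q \<le> t" "t < r" "\<not> osc (\<lambda>t. X t \<omega>) e p (D \<inter> {q..r})"
        using osc_bounded[OF \<omega> te(2,1)] by blast
      have "D \<inter> {t<..<r} \<subseteq> D \<inter> {q..r}" using * by auto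
      with * show ?thesis using osc_mono by blast
    qed
    have left: "\<exists>p. \<exists>d<t. \<not> osc (\<lambda>t. X t \<omega>) e p (D \<inter> {d<..<t})" if te: "0 < e" "0 < t" for e t
    proof -
      obtain q r p where *: "q < t" "t < r" "\<not> osc (\<lambda>t. X t \<omega>) e p (D \<inter> {q..r})"
        using osc_bounded[OF \<omega> _ te(1), of t] te(2) by auto
      have "D \<inter> {q<..<t} \<subseteq> D \<inter> {q..r}" using * by auto
      with * show ?thesis using osc_mono by blast
    qed
    have Z: "Z t \<omega> = l" if "0 \<le> t" "((\<lambda>s. X s \<omega>) \<longlongrightarrow> l) (at t within (D \<inter> {t<..}))" for t l
      using that \<omega> nontriv by (simp add: Z_def tendsto_Lim)
    note limits = cadlag_right_limits[where x = "\<lambda>s. X s \<omega>" and z = "\<lambda>t. Z t \<omega>" and D = D]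
    have "cadlag (\<lambda>t. Z t \<omega>)"
      by (rule limits(1)) (fact D_dense right left Z)+
    moreover have "((\<lambda>s. X s \<omega>) \<longlongrightarrow> Z t \<omega>) (at t within (D \<inter> {t<..}))" if "0 \<le> t" for t
      by (rule limits(2)) (fact D_dense right left Z that)+
    ultimately show ?thesis by blast
  qed
  \<comment> \<open>One sequence of times serves all paths in \<open>G\<close>. Thus
    \<open>Z t\<close> is a pointwise limit of measurable maps, and \<open>AE_limit_eq\<close>
    becomes applicable.\<close>
  have Z_seq: "\<exists>s. (\<forall>n. t \<le> s n) \<and> s \<longlonglongrightarrow> t \<and> (\<forall>\<omega>\<in>G. (\<lambda>n. X (s n) \<omega>) \<longlonglongrightarrow> Z t \<omega>)" if "0 \<le> t" for t
  proof -
    have "\<forall>n. \<exists>d\<in>D. t < d \<and> d < t + 1 / real (Suc n)" using D_dense[OF that] by auto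
    then obtain s where s: "\<And>n. s n \<in> D" "\<And>n. t < s n" "\<And>n. s n < t + 1 / real (Suc n)" by metis
    have lim: "s \<longlonglongrightarrow> t"
    proof (rule tendsto_sandwich[OF _ _ tendsto_const])
      show "(\<lambda>n. t + 1 / real (Suc n)) \<longlonglongrightarrow> t"
        using tendsto_add[OF tendsto_const LIMSEQ_Suc[OF lim_1_over_n]] by fastforce
    qed (use s in \<open>auto intro!: always_eventually less_imp_le\<close>)
    then have "filterlim s (at t within (D \<inter> {t<..})) sequentially"
      using s(1,2) by (auto simp: filterlim_at less_imp_neq[OF s(2)] intro!: always_eventually)
    then have "(\<lambda>n. X (s n) \<omega>) \<longlonglongrightarrow> Z t \<omega>" if "\<omega> \<in> G" for \<omega>
      using Z_path[OF that] \<open>0 \<le> t\<close> by (auto intro: filterlim_compose)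
    with lim s(2) show ?thesis by (intro exI[of _ s]) (auto intro: less_imp_le)
  qed
  have Z_meas: "Z t \<in> borel_measurable M" if t: "0 \<le> t" for t
  proof -
    obtain s where s: "\<And>n. t \<le> s n" "\<And>\<omega>. \<omega> \<in> G \<Longrightarrow> (\<lambda>n. X (s n) \<omega>) \<longlonglongrightarrow> Z t \<omega>"
      using Z_seq[OF t] by blast
    have [measurable]: "X (s n) \<in> borel_measurable M" for n
      using t s(1)[of n] by (intro X_measurable) linarith
    show ?thesis
    proof (rule borel_measurable_LIMSEQ_metric)
      show "(\<lambda>\<omega>. if \<omega> \<in> G then X (s n) \<omega> else 0) \<in> borel_measurable M" for n by measurable
      show "(\<lambda>n. if \<omega> \<in> G then X (s n) \<omega> else 0) \<longlonglongrightarrow> Z t \<omega>" for \<omega>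
        using s(2) by (cases "\<omega> \<in> G") (auto simp: Z_def)
    qed
  qed
  show ?thesis
  proof (rule that)
    show "Z t \<in> borel_measurable M" if "0 \<le> t" for t by (rule Z_meas[OF that])
    show "cadlag (\<lambda>t. Z t \<omega>)" for \<omega>
    proof (cases "\<omega> \<in> G")
      case True
      then show ?thesis using Z_path by blast
    next
      case False
      then have "(\<lambda>t. Z t \<omega>) = (\<lambda>_. 0)" by (auto simp: Z_def)
      then show ?thesis by (auto simp: cadlag_def)
    qed
    fix t :: real assume t: "0 \<le> t"
    obtain s where s: "\<And>n. t \<le> s n" "s \<longlonglongrightarrow> t" "\<And>\<omega>. \<omega> \<in> G \<Longrightarrow> (\<lambda>n. X (s n) \<omega>) \<longlonglongrightarrow> Z t \<omega>"
      using Z_seq[OF t] by blast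
    have "AE \<omega> in M. (\<lambda>n. X (s n) \<omega>) \<longlonglongrightarrow> Z t \<omega>"
      using AE_G by eventually_elim (rule s(3))
    then show "AE \<omega> in M. Z t \<omega> = X t \<omega>"
      by (intro AE_limit_eq[OF t s(1,2)] Z_meas t)
  qed
qed

end

text \<open>The sample space is the space of functions of time because the process before
  modification is the coordinate process. Modification at fixed times preserves the laws and the
  independence of increments, so only \<open>\<rho> (t - s)\<close> and \<open>T s\<close> remain to
  be compared.\<close>

theorem corollary2:
  fixes P :: "real \<Rightarrow> ('e::{banach, second_countable_topology} \<Rightarrow>\<^sub>C real) \<Rightarrow>\<^sub>L ('e \<Rightarrow>\<^sub>C real)"
    and T :: "real \<Rightarrow> 'e \<Rightarrow>\<^sub>L 'e"
    and \<rho> :: "real \<Rightarrow> 'e measure"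
  assumes "generalized_Mehler_semigroup P T \<rho>"
    and "weakly_tendsto \<rho> (\<rho> 0) (at 0 within {0..})"
  shows "C0_semigroup T \<and>
    (\<exists>(M :: (real \<Rightarrow> 'e) measure) (Z :: real \<Rightarrow> (real \<Rightarrow> 'e) \<Rightarrow> 'e).
       prob_space M \<and>
       (\<forall>t\<ge>0. Z t \<in> borel_measurable M) \<and>
       (\<forall>\<omega>\<in>space M. cadlag (\<lambda>t. Z t \<omega>)) \<and>
       independent_increments M Z \<and>
       (AE \<omega> in M. Z 0 \<omega> = 0) \<and>
       (\<forall>s\<ge>0. \<forall>t\<ge>s. distr M borel (\<lambda>\<omega>. Z t \<omega> - Z s \<omega>) = distr M borel (\<lambda>\<omega>. T s (Z (t - s) \<omega>))) \<and>
       (\<forall>t\<ge>0. \<forall>(f :: 'e \<Rightarrow>\<^sub>C real) x. P t f x = (\<integral>\<omega>. f (T t x + Z t \<omega>) \<partial>M)))"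
proof (intro conjI)
  show C0: "C0_semigroup T"
    using assms(1) by (simp add: generalized_Mehler_semigroup_def)
  define \<mu> where "\<mu> = (\<lambda>s t. distr (\<rho> (t - s)) borel (T s))"
  interpret convolution_hemigroup \<mu>
    unfolding \<mu>_def by (rule Mehler_hemigroup[OF assms])
  obtain M where "additive_process \<mu> M (\<lambda>t \<omega>. \<omega> t)"
    by (rule additive_process_exists)
  then interpret additive_process \<mu> M "\<lambda>t \<omega>. \<omega> t" .
  obtain Z where Z_meas: "\<And>t. 0 \<le> t \<Longrightarrow> Z t \<in> borel_measurable M"
    and Z_cadlag: "\<And>\<omega>. \<omega> \<in> space M \<Longrightarrow> cadlag (\<lambda>t. Z t \<omega>)"
    and Z_eq: "\<And>t. 0 \<le> t \<Longrightarrow> AE \<omega> in M. Z t \<omega> = \<omega> t"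
    using cadlag_modification by blast
  have T_meas: "blinfun_apply (T s) \<in> borel_measurable borel" for s
    by (intro borel_measurable_continuous_onI) (simp add: blinfun.continuous_on)
  have Z_start: "AE \<omega> in M. Z 0 \<omega> = 0"
    using Z_eq[of 0] X_start by (auto elim: AE_mp)
  have Z_increment: "distr M borel (\<lambda>\<omega>. Z t \<omega> - Z s \<omega>) = distr (\<rho> (t - s)) borel (T s)"
    if st: "0 \<le> s" "s \<le> t" for s t
  proof -
    have ae: "AE \<omega> in M. Z t \<omega> - Z s \<omega> = \<omega> t - \<omega> s"
      using Z_eq[of s] Z_eq[of t] st by auto
    have "distr M borel (\<lambda>\<omega>. Z t \<omega> - Z s \<omega>) = distr M borel (\<lambda>\<omega>. \<omega> t - \<omega> s)"
      using st by (intro distr_cong_AE ae refl borel_measurable_diff Z_meas X_measurable) auto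
    then show ?thesis using X_increment[OF st] by (simp add: \<mu>_def)
  qed
  \<comment> \<open>The increment from time \<open>0\<close> has the law \<open>\<rho> t\<close>, as
    \<open>T 0\<close> is the identity and \<open>Z 0\<close> vanishes almost surely.\<close>
  have Z_law: "distr M borel (Z t) = \<rho> t" if t: "0 \<le> t" for t
  proof -
    have ae: "AE \<omega> in M. Z t \<omega> = Z t \<omega> - Z 0 \<omega>"
      using Z_start by auto
    have T0: "blinfun_apply (T 0) = (\<lambda>x. x)"
      using C0 by (simp add: C0_semigroup_def fun_eq_iff)
    have "distr M borel (Z t) = distr M borel (\<lambda>\<omega>. Z t \<omega> - Z 0 \<omega>)"
      using t by (intro distr_cong_AE ae refl borel_measurable_diff Z_meas) auto
    also have "\<dots> = distr (\<rho> t) borel (\<lambda>x. x)"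
      using Z_increment[of 0 t] t by (simp add: T0)
    also have "\<dots> = \<rho> t"
      using assms(1) t by (intro distr_id2) (simp add: generalized_Mehler_semigroup_def)
    finally show ?thesis .
  qed
  \<comment> \<open>Both sides are the image of \<open>\<rho> (t - s)\<close> under
    \<open>T s\<close>: the left one as the law of an increment, the right one by
    \<open>Z_law\<close>.\<close>
  have Z_shift: "distr M borel (\<lambda>\<omega>. Z t \<omega> - Z s \<omega>) = distr M borel (\<lambda>\<omega>. T s (Z (t - s) \<omega>))"
    if st: "0 \<le> s" "s \<le> t" for s t
  proof -
    have "distr M borel (\<lambda>\<omega>. T s (Z (t - s) \<omega>)) = distr (distr M borel (Z (t - s))) borel (T s)"
      using st by (subst distr_distr) (auto simp: comp_def intro!: T_meas Z_meas)
    then show ?thesis using Z_law[of "t - s"] Z_increment[OF st] st by simp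
  qed
  have Z_indep: "independent_increments M Z"
    unfolding independent_increments_def
  proof (intro allI impI, elim conjE)
    fix n and t :: "nat \<Rightarrow> real" assume t: "0 \<le> t 0" "\<forall>i<n. t i \<le> t (Suc i)"
    have t_nonneg: "0 \<le> t i" if "i \<le> n" for i
      using that
    proof (induction i)
      case (Suc i)
      then show ?case using t(2)[rule_format, of i] by simp
    qed (simp add: t)
    show "indep_vars (\<lambda>_. borel) (\<lambda>i \<omega>. Z (t (Suc i)) \<omega> - Z (t i) \<omega>) {..<n}"
    proof (rule indep_vars_cong_AE)
      show "indep_vars (\<lambda>_. borel) (\<lambda>i \<omega>. \<omega> (t (Suc i)) - \<omega> (t i)) {..<n}"
        using X_indep t unfolding independent_increments_def by blast
      fix i assume "i \<in> {..<n}"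
      then have i: "0 \<le> t i" "0 \<le> t (Suc i)" by (auto intro: t_nonneg)
      show "(\<lambda>\<omega>. Z (t (Suc i)) \<omega> - Z (t i) \<omega>) \<in> borel_measurable M"
        by (intro borel_measurable_diff Z_meas i)
      show "AE \<omega> in M. \<omega> (t (Suc i)) - \<omega> (t i) = Z (t (Suc i)) \<omega> - Z (t i) \<omega>"
        using Z_eq[OF i(1)] Z_eq[OF i(2)] by auto
    qed auto
  qed
  have Z_repr: "P t f x = (\<integral>\<omega>. f (T t x + Z t \<omega>) \<partial>M)" if t: "0 \<le> t" for t f x
  proof -
    have "P t f x = (\<integral>y. f (T t x + y) \<partial>distr M borel (Z t))"
      using assms(1) t by (simp add: generalized_Mehler_semigroup_def Z_law)
    also have "\<dots> = (\<integral>\<omega>. f (T t x + Z t \<omega>) \<partial>M)"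
      using t by (intro integral_distr Z_meas) measurable
    finally show ?thesis .
  qed
  show "\<exists>(M :: (real \<Rightarrow> 'e) measure) (Z :: real \<Rightarrow> (real \<Rightarrow> 'e) \<Rightarrow> 'e).
       prob_space M \<and>
       (\<forall>t\<ge>0. Z t \<in> borel_measurable M) \<and>
       (\<forall>\<omega>\<in>space M. cadlag (\<lambda>t. Z t \<omega>)) \<and>
       independent_increments M Z \<and>
       (AE \<omega> in M. Z 0 \<omega> = 0) \<and>
       (\<forall>s\<ge>0. \<forall>t\<ge>s. distr M borel (\<lambda>\<omega>. Z t \<omega> - Z s \<omega>) = distr M borel (\<lambda>\<omega>. T s (Z (t - s) \<omega>))) \<and>
       (\<forall>t\<ge>0. \<forall>(f :: 'e \<Rightarrow>\<^sub>C real) x. P t f x = (\<integral>\<omega>. f (T t x + Z t \<omega>) \<partial>M))"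
    by (intro exI[of _ M] exI[of _ Z] conjI ballI allI impI)
      (assumption | rule prob_space_axioms Z_meas Z_cadlag Z_indep Z_start Z_shift Z_repr)+
qed

end
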